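(* Let $\Theta$ be a finite set, $1\le T\le\infty$, $\mu\in\operatorname{int}\Delta(\Theta)$ a prior, and $\beta=(\beta_t)_{t=1}^T$ a sequence of nonnegative reals with $0<\bar\beta:=\sum_{t=1}^T\beta_t<\infty$. Let $\pi_1$ and $\pi_2$ be two dynamic information structures with horizon $T$, inducing at prior $\mu$ the sequences $(F_t)_{t=1}^T$ and $(G_t)_{t=1}^T$, respectively, of period-$t$ distributions over posteriors, and put $$F^\beta=\sum_{t=1}^T\frac{\beta_t}{\bar\beta}F_t,\qquad G^\beta=\sum_{t=1}^T\frac{\beta_t}{\bar\beta}G_t .$$ Then $\pi_1$ dominates $\pi_2$ in the class of $\beta$-discounted problems, i.e. $W(\pi_1)\ge W(\pi_2)$ for every $\beta$-discounted problem with state space $\Theta$ and horizon $T$, if and only if $F^\beta\succeq G^\beta$.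
   Context: Periods are $t\in\{1,\dots,T\}$ (all positive integers if $T=\infty$). $\Delta(X)$ denotes the probability measures on $X$. Dynamic information structure: compact signal spaces $S_1,\dots,S_T$ and a stochastic map $\pi:\Theta\to\Delta(S)$, $S=\prod_t S_t$. The agent observes $s_t\in S_t$ in period $t$ before acting, so in period $t$ she knows $s^t=(s_1,\dots,s_t)$. With $\theta\sim\mu$ and $s\mid\theta\sim\pi(\cdot\mid\theta)$, the period-$t$ distribution over posteriors, an element of $\Delta(\Delta(\Theta))$, is the law of the posterior belief about $\theta$ conditional on $s^t$. $\beta$-discounted problem (for the given $\beta$): a nonempty compact action set $A^*$, available in every period, and a continuous $v:A^*\times\Theta\to\mathbb{R}$; the total utility is $\sum_{t=1}^T\beta_t v(a_t,\theta)$. Value of a signal: put $V(x)=\max_{a\in A^*}\sum_\theta x(\theta)v(a,\theta)$ for $x\in\Delta(\Theta)$. The agent's optimal ex ante expected utility under a structure $\pi$ with period-$t$ posterior distributions $F_t$ is $W(\pi)=\sum_{t=1}^T\beta_t\,\mathbb{E}_{x\sim F_t}[V(x)]$. $F\succeq G$, for $F,G\in\Delta(\Delta(\Theta))$, means that $F$ is a mean-preserving spread of $G$: there are random vectors $X\sim F$, $Y\sim G$ on a common probability space with $\mathbb{E}[X\mid Y]=Y$ (equivalently, $\mathbb{E}_F\varphi\ge\mathbb{E}_G\varphi$ for every continuous convex $\varphi:\Delta(\Theta)\to\mathbb{R}$). *)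

theory Defs
  imports "HOL-Probability.Probability" "HOL-Library.Infinite_Typeclass"
begin

definition periods :: "enat \<Rightarrow> nat set" where
  "periods T = {t. 1 \<le> t \<and> enat t \<le> T}"

definition beliefs :: "(real ^ 'n::finite) set" where
  "beliefs = {x. (\<forall>\<theta>. 0 \<le> x $ \<theta>) \<and> (\<Sum>\<theta>\<in>UNIV. x $ \<theta>) = 1}"

definition belief_space :: "(real ^ 'n::finite) measure" where
  "belief_space = restrict_space borel beliefs"

definition borel_of :: "'a topology \<Rightarrow> 'a measure" where
  "borel_of X = sigma (topspace X) {U. openin X U}"

text \<open>The signal spaces have carriers in a common type only for typing reasons; carriers and
  topologies may vary with \<open>t\<close>. The product carries the product \<open>\<sigma>\<close>-algebra.\<close>

definition signal_space :: "enat \<Rightarrow> (nat \<Rightarrow> 's topology) \<Rightarrow> (nat \<Rightarrow> 's) measure" where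
  "signal_space T S = (\<Pi>\<^sub>M t\<in>periods T. borel_of (S t))"

text \<open>The state space is finite, hence discrete, so every family of probability measures
  indexed by it is a stochastic map.\<close>

definition dynamic_information_structure ::
    "enat \<Rightarrow> (nat \<Rightarrow> 's topology) \<Rightarrow> ('n::finite \<Rightarrow> (nat \<Rightarrow> 's) measure) \<Rightarrow> bool" where
  "dynamic_information_structure T S \<pi> \<longleftrightarrow>
     (\<forall>t\<in>periods T. compact_space (S t)) \<and>
     (\<forall>\<theta>. \<pi> \<theta> \<in> space (prob_algebra (signal_space T S)))"

text \<open>The law of the pair of state and signal path.\<close>

definition joint_law ::
    "enat \<Rightarrow> real ^ 'n::finite \<Rightarrow> (nat \<Rightarrow> 's topology) \<Rightarrow> ('n \<Rightarrow> (nat \<Rightarrow> 's) measure)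
      \<Rightarrow> ('n \<times> (nat \<Rightarrow> 's)) measure" where
  "joint_law T \<mu> S \<pi> =
     point_measure UNIV (\<lambda>\<theta>. ennreal (\<mu> $ \<theta>)) \<bind>
       (\<lambda>\<theta>. distr (\<pi> \<theta>) (count_space UNIV \<Otimes>\<^sub>M signal_space T S) (Pair \<theta>))"

text \<open>The \<open>\<sigma>\<close>-algebra generated by the signal history up to period \<open>t\<close>.\<close>

definition history_algebra ::
    "enat \<Rightarrow> (nat \<Rightarrow> 's topology) \<Rightarrow> nat \<Rightarrow> ('n::finite \<times> (nat \<Rightarrow> 's)) measure" where
  "history_algebra T S t =
     vimage_algebra (UNIV \<times> space (signal_space T S))
       (\<lambda>(\<theta>, s). restrict s {1..t}) (\<Pi>\<^sub>M r\<in>{1..t}. borel_of (S r))"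

definition posterior ::
    "enat \<Rightarrow> real ^ 'n::finite \<Rightarrow> (nat \<Rightarrow> 's topology) \<Rightarrow> ('n \<Rightarrow> (nat \<Rightarrow> 's) measure)
      \<Rightarrow> nat \<Rightarrow> 'n \<times> (nat \<Rightarrow> 's) \<Rightarrow> real ^ 'n" where
  "posterior T \<mu> S \<pi> t \<omega> =
     (\<chi> \<theta>. real_cond_exp (joint_law T \<mu> S \<pi>) (history_algebra T S t)
             (indicator ({\<theta>} \<times> UNIV)) \<omega>)"

text \<open>A version of the conditional probabilities lies in \<open>beliefs\<close> only almost surely.
  Hence the law is first formed on the ambient space and then restricted; no mass is lost.\<close>

definition posterior_law ::
    "enat \<Rightarrow> real ^ 'n::finite \<Rightarrow> (nat \<Rightarrow> 's topology) \<Rightarrow> ('n \<Rightarrow> (nat \<Rightarrow> 's) measure)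
      \<Rightarrow> nat \<Rightarrow> (real ^ 'n) measure" where
  "posterior_law T \<mu> S \<pi> t =
     restrict_space (distr (joint_law T \<mu> S \<pi>) borel (posterior T \<mu> S \<pi> t)) beliefs"

text \<open>The mixture of the \<open>F t\<close> with weights \<open>\<beta> t\<close> divided by their sum.\<close>

definition discounted_average ::
    "enat \<Rightarrow> (nat \<Rightarrow> real) \<Rightarrow> (nat \<Rightarrow> (real ^ 'n::finite) measure) \<Rightarrow> (real ^ 'n) measure" where
  "discounted_average T \<beta> F =
     measure_of beliefs (sets belief_space)
       (\<lambda>B. \<Sum>\<^sub>\<infinity>t\<in>periods T. ennreal (\<beta> t / (\<Sum>\<^sub>\<infinity>r\<in>periods T. \<beta> r)) * emeasure (F t) B)"

text \<open>The action space is a topology \<open>A\<close> with carrier in some ambient type \<open>'a\<close>. Statements about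
  all decision problems quantify over all \<open>A\<close> on a fixed \<open>'a\<close>, where \<open>'a :: infinite\<close> is itself
  arbitrary: every compact space occurs for a suitable \<open>'a\<close>, whereas over a finite ambient type
  the class of problems would contain only finite action sets of bounded size.\<close>

definition decision_problem :: "'a topology \<Rightarrow> ('a \<times> 'n::finite \<Rightarrow> real) \<Rightarrow> bool" where
  "decision_problem A v \<longleftrightarrow>
     compact_space A \<and> topspace A \<noteq> {} \<and>
     continuous_map (prod_topology A (discrete_topology UNIV)) euclideanreal v"

text \<open>For a decision problem the supremum is attained, by compactness and continuity.\<close>

definition indirect_utility ::
    "'a topology \<Rightarrow> ('a \<times> 'n::finite \<Rightarrow> real) \<Rightarrow> real ^ 'n \<Rightarrow> real" where
  "indirect_utility A v x = (SUP a\<in>topspace A. \<Sum>\<theta>\<in>UNIV. x $ \<theta> * v (a, \<theta>))"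

definition optimal_utility ::
    "enat \<Rightarrow> (nat \<Rightarrow> real) \<Rightarrow> real ^ 'n::finite \<Rightarrow> (nat \<Rightarrow> 's topology)
      \<Rightarrow> ('n \<Rightarrow> (nat \<Rightarrow> 's) measure) \<Rightarrow> 'a topology \<Rightarrow> ('a \<times> 'n \<Rightarrow> real) \<Rightarrow> real" where
  "optimal_utility T \<beta> \<mu> S \<pi> A v =
     (\<Sum>\<^sub>\<infinity>t\<in>periods T. \<beta> t * (\<integral>x. indirect_utility A v x \<partial>posterior_law T \<mu> S \<pi> t))"

text \<open>\<open>F\<close> is a mean-preserving spread of \<open>G\<close>. Fixing the type of the sample space loses
  nothing: whether a coupling \<open>(X, Y)\<close> works depends only on its joint law, which lives on
  pairs of vectors. The conditional expectation is taken coordinatewise.\<close>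

definition mean_preserving_spread ::
    "(real ^ 'n::finite) measure \<Rightarrow> (real ^ 'n) measure \<Rightarrow> bool" (infix "\<succeq>" 50) where
  "F \<succeq> G \<longleftrightarrow>
     (\<exists>(M :: ((real ^ 'n) \<times> (real ^ 'n)) measure) X Y.
        prob_space M \<and>
        X \<in> M \<rightarrow>\<^sub>M belief_space \<and> distr M belief_space X = F \<and>
        Y \<in> M \<rightarrow>\<^sub>M belief_space \<and> distr M belief_space Y = G \<and>
        (\<forall>\<theta>. AE \<omega> in M.
           real_cond_exp M (vimage_algebra (space M) Y belief_space) (\<lambda>\<omega>. X \<omega> $ \<theta>) \<omega> = Y \<omega> $ \<theta>))"

end

theory Submission
  imports Defs
begin

text \<open>Integrals of the indirect utilities of finite decision problems are integrals of maxima of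
  finitely many linear functions, and discounting only mixes the posterior laws. So dominance says
  that the discounted law \<open>F\<close> beats \<open>G\<close> on all such maxima. What remains is Strassen's theorem: a
  law that is larger on maxima of linear functions is a mean-preserving spread.

  For a partition of the beliefs into finitely many cells, duality with the argmax partition yields
  partitions of unity \<open>p\<close> whose \<open>F\<close>-moments \<open>\<integral>x. p j x *\<^sub>R x \<partial>F\<close> approximate the \<open>G\<close>-moments of the
  cells. To pass to the limit without a compactness theorem for measures, beliefs are encoded as
  real numbers, and the approximate conditional survival functions of the code given \<open>X\<close> are chosen
  with nearly minimal \<open>L\<^sup>2\<close> norm, which makes them converge almost everywhere along a subsequence.
  Inverting the limit at an independent uniform level samples \<open>Y\<close> with \<open>E[X | Y] = Y\<close>.\<close>

subsection \<open>Encoding vectors as real numbers\<close>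

text \<open>A pair with E[X | Y] = Y and Y distributed as \<open>G\<close> is characterized by
  vector moments: for every Borel set B, the integral of X over the event that Y lies in B equals
  the integral of y over B under \<open>G\<close>. Since the coordinates of a belief sum to 1, these
  equations also fix the law of Y, so the second marginal needs no constraint of its own. They are
  linear in the conditional law of Y given X. For a finite partition, the moments attainable from
  \<open>F\<close> form a convex set whose support function at \<open>b\<close> is the integral of
  \<open>max_lin n b\<close>; this is where the order enters. The obstacle is exact solvability:
  each finite partition gives only approximate solutions, unrelated to those of finer partitions.
  Coding Y by a single real number turns its conditional law into countably many monotone functions
  with values in [0, 1]. Almost everywhere convergence is then enough, because range, monotonicity
  and moments all pass to the limit.\<close>

lemma floor_double: "\<lfloor>2 * t\<rfloor> = 2 * \<lfloor>t\<rfloor> + \<lfloor>2 * t\<rfloor> mod 2" for t :: real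
proof -
  have "\<lfloor>2 * t\<rfloor> div 2 = \<lfloor>t\<rfloor>"
    using floor_divide_real_eq_div[of 2 "2 * t"] by simp
  then show ?thesis
    by (metis mult_div_mod_eq)
qed

text \<open>By \<open>floor_double\<close> the partial sums collapse to
  \<open>\<lfloor>2 ^ n * t\<rfloor> / 2 ^ n\<close>. The expansion starts with the units digit, so
  that the coordinate value 1 of a degenerate belief is covered.\<close>

lemma binary_expansion_sums:
  fixes t :: real
  assumes "0 \<le> t" "t < 2"
  shows "(\<lambda>k. of_int (\<lfloor>2 ^ k * t\<rfloor> mod 2) / 2 ^ k) sums t"
proof -
  have partial: "(\<Sum>k\<le>n. real_of_int (\<lfloor>2 ^ k * t\<rfloor> mod 2) / 2 ^ k) = of_int \<lfloor>2 ^ n * t\<rfloor> / 2 ^ n" for n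
  proof (induction n)
    case 0
    have "\<lfloor>t\<rfloor> mod 2 = \<lfloor>t\<rfloor>"
      using assms by (intro mod_pos_pos_trivial) (auto simp: floor_less_iff)
    then show ?case by simp
  next
    case (Suc n)
    have "\<lfloor>2 ^ Suc n * t\<rfloor> = 2 * \<lfloor>2 ^ n * t\<rfloor> + \<lfloor>2 ^ Suc n * t\<rfloor> mod 2"
      using floor_double[of "2 ^ n * t"] by (simp add: mult.assoc)
    then have "real_of_int \<lfloor>2 ^ Suc n * t\<rfloor> =
        2 * of_int \<lfloor>2 ^ n * t\<rfloor> + of_int (\<lfloor>2 ^ Suc n * t\<rfloor> mod 2)"
      by (metis of_int_add of_int_mult of_int_numeral)
    then show ?case
      unfolding sum.atMost_Suc Suc by (simp add: field_simps)
  qed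
  have "(\<lambda>n. real_of_int \<lfloor>2 ^ n * t\<rfloor> / 2 ^ n) \<longlonglongrightarrow> t"
  proof (rule real_tendsto_sandwich)
    show "\<forall>\<^sub>F n in sequentially. t - (1/2) ^ n \<le> of_int \<lfloor>2 ^ n * t\<rfloor> / 2 ^ n"
    proof (intro always_eventually allI)
      fix n
      have "t - (1/2) ^ n = (2 ^ n * t - 1) / 2 ^ n"
        by (simp add: field_simps)
      also have "\<dots> \<le> of_int \<lfloor>2 ^ n * t\<rfloor> / 2 ^ n"
        by (rule divide_right_mono) (linarith, simp)
      finally show "t - (1/2) ^ n \<le> of_int \<lfloor>2 ^ n * t\<rfloor> / 2 ^ n" .
    qed
    show "\<forall>\<^sub>F n in sequentially. of_int \<lfloor>2 ^ n * t\<rfloor> / 2 ^ n \<le> t"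
    proof (intro always_eventually allI)
      fix n
      have "of_int \<lfloor>2 ^ n * t\<rfloor> \<le> 2 ^ n * t" by linarith
      then show "of_int \<lfloor>2 ^ n * t\<rfloor> / 2 ^ n \<le> t"
        by (simp add: field_simps)
    qed
    have "(\<lambda>n. (1/2::real) ^ n) \<longlonglongrightarrow> 0" by (rule LIMSEQ_realpow_zero) auto
    from tendsto_diff[OF tendsto_const this, of t]
    show "(\<lambda>n. t - (1/2) ^ n) \<longlonglongrightarrow> t" by simp
  qed simp
  then show ?thesis
    unfolding sums_def_le partial .
qed

text \<open>With digits at most 1, the tail behind a position is worth at most 1/3 of a unit of that
  position, so the floor cuts it off without a carry. In base 2 a tail of ones would add up to a
  full unit.\<close>

lemma quaternary_digit:
  fixes b :: "nat \<Rightarrow> int"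
  assumes b: "\<And>j. b j \<in> {0, 1}"
  shows "\<lfloor>4 ^ Suc j * (\<Sum>i. real_of_int (b i) / 4 ^ Suc i)\<rfloor> mod 4 = b j"
    and "(\<Sum>i. real_of_int (b i) / 4 ^ Suc i) \<in> {0..1/2}"
proof -
  define Z where "Z b = (\<Sum>i. real_of_int (b i) / 4 ^ Suc i)" for b
  have geo: "(\<lambda>i. (1/4::real) ^ Suc i) sums (1/3)"
    using sums_mult[OF geometric_sums[of "1/4::real"], of "1/4"] by simp
  have le: "real_of_int (b i) / 4 ^ Suc i \<le> (1/4) ^ Suc i" "0 \<le> real_of_int (b i) / 4 ^ Suc i"
    if "\<And>j. b j \<in> {0, 1}" for b i
    using that[of i] by (auto simp: power_divide)
  have sm: "summable (\<lambda>i. real_of_int (b i) / 4 ^ Suc i)" if "\<And>j. b j \<in> {0, 1}" for b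
  proof (rule summable_comparison_test'[OF sums_summable[OF geo], of 0])
    show "norm (real_of_int (b i) / 4 ^ Suc i) \<le> (1/4) ^ Suc i" for i
      using le[of b i, OF that] by (simp only: real_norm_def abs_of_nonneg)
  qed
  have bnd: "0 \<le> Z b" "Z b \<le> 1/3" if "\<And>j. b j \<in> {0, 1}" for b
    unfolding Z_def
    subgoal by (intro suminf_nonneg sm le that)
    subgoal
      using suminf_le[OF le(1)[of b, OF that] sm[of b, OF that] sums_summable[OF geo]] sums_unique[OF geo]
      by simp
    done
  have step: "4 * Z b = b 0 + Z (\<lambda>i. b (Suc i))" if "\<And>j. b j \<in> {0, 1}" for b
  proof -
    have "Z (\<lambda>i. b (Suc i)) / 4 = (\<Sum>i. real_of_int (b (Suc i)) / 4 ^ Suc i / 4)"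
      unfolding Z_def by (rule suminf_divide[symmetric]) (intro sm that)
    then show ?thesis
      using suminf_split_head[OF sm[of b, OF that]] unfolding Z_def by (simp add: mult.commute)
  qed
  \<comment> \<open>\<open>N\<close> is the integer formed by the digits before \<open>j\<close>.
    Its multiple by 4 vanishes modulo 4, and the shifted expansion vanishes under the floor.\<close>
  have main: "\<exists>N::int. 4 ^ Suc j * Z b = 4 * of_int N + b j + Z (\<lambda>i. b (i + Suc j))" for j
  proof (induction j)
    case 0
    show ?case by (rule exI[of _ 0]) (use step[OF b] in simp)
  next
    case (Suc j)
    then obtain N :: int where "4 ^ Suc j * Z b = 4 * of_int N + b j + Z (\<lambda>i. b (i + Suc j))" by blast
    then have "4 ^ Suc (Suc j) * Z b = 4 * (4 * of_int N + b j) + 4 * Z (\<lambda>i. b (i + Suc j))"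
      by simp
    also have "4 * Z (\<lambda>i. b (i + Suc j)) = b (Suc j) + Z (\<lambda>i. b (i + Suc (Suc j)))"
      using step[of "\<lambda>i. b (i + Suc j)"] b by simp
    finally show ?case
      by (intro exI[of _ "4 * N + b j"]) simp
  qed
  from main[of j] obtain N :: int
    where N: "4 ^ Suc j * Z b = 4 * of_int N + b j + Z (\<lambda>i. b (i + Suc j))" by blast
  have "\<lfloor>4 ^ Suc j * Z b\<rfloor> = 4 * N + b j"
    unfolding N by (rule floor_unique) (use bnd[of "\<lambda>i. b (i + Suc j)"] b in auto)
  moreover have "(4 * N + b j) mod 4 = b j"
    using b[of j] by (auto simp: mod_mult_self4 intro: mod_pos_pos_trivial)
  ultimately show "\<lfloor>4 ^ Suc j * (\<Sum>i. real_of_int (b i) / 4 ^ Suc i)\<rfloor> mod 4 = b j"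
    unfolding Z_def by simp
  show "(\<Sum>i. real_of_int (b i) / 4 ^ Suc i) \<in> {0..1/2}"
    using bnd[of b, OF b] unfolding Z_def by auto
qed

text \<open>The binary digits of all coordinates are interleaved into one base-4 expansion with digits
  0 and 1 only, so that they can be read off again without ambiguity.\<close>

lemma borel_embedding_real:
  obtains c :: "real ^ 'n::finite \<Rightarrow> real" and \<psi> :: "real \<Rightarrow> real ^ 'n"
  where "c \<in> borel_measurable borel" "\<psi> \<in> borel_measurable borel" "\<And>y. c y \<in> {0..1}"
    and "\<And>y. \<forall>i. 0 \<le> y $ i \<and> y $ i < 2 \<Longrightarrow> \<psi> (c y) = y"
proof -
  \<comment> \<open>Digit \<open>j\<close> of the code is binary digit \<open>k\<close> of
    coordinate \<open>i\<close>, where \<open>(k, i)\<close> is decoded from \<open>j\<close>.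
    Indices outside the range of \<open>to_nat\<close> may contribute surplus digits, which
    \<open>\<psi>\<close> never reads.\<close>
  define d :: "real ^ 'n \<Rightarrow> nat \<Rightarrow> int"
    where "d y j = \<lfloor>2 ^ fst (from_nat j :: nat \<times> 'n) * y $ snd (from_nat j :: nat \<times> 'n)\<rfloor> mod 2" for y j
  define c where "c y = (\<Sum>j. real_of_int (d y j) / 4 ^ Suc j)" for y
  define \<psi> :: "real \<Rightarrow> real ^ 'n" where "\<psi> z =
    (\<chi> i. \<Sum>k. of_int (\<lfloor>4 ^ Suc (to_nat (k, i)) * z\<rfloor> mod 4) / 2 ^ k)" for z
  have d01: "d y j \<in> {0, 1}" for y j
    unfolding d_def by auto
  show thesis
  proof
    have [measurable]: "(\<lambda>y :: real ^ 'n. y $ i) \<in> borel_measurable borel" for i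
      by (intro borel_measurable_continuous_onI continuous_intros)
    show "c \<in> borel_measurable borel"
      unfolding c_def d_def by measurable
    show "\<psi> \<in> borel_measurable borel"
      unfolding \<psi>_def
      by (subst borel_measurable_euclidean_space) (auto simp: Basis_vec_def inner_axis)
    show "c y \<in> {0..1}" for y
      using quaternary_digit(2)[of "d y"] d01 unfolding c_def by auto
    show "\<psi> (c y) = y" if y: "\<forall>i. 0 \<le> y $ i \<and> y $ i < 2" for y
    proof (subst vec_eq_iff, rule allI)
      fix i
      have "\<lfloor>4 ^ Suc (to_nat (k, i)) * c y\<rfloor> mod 4 = \<lfloor>2 ^ k * y $ i\<rfloor> mod 2" for k
        using quaternary_digit(1)[of "d y" "to_nat (k, i)"] d01 unfolding c_def by (simp add: d_def)
      then show "\<psi> (c y) $ i = y $ i"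
        using sums_unique[OF binary_expansion_sums[of "y $ i"]] y unfolding \<psi>_def by simp
    qed
  qed
qed

subsection \<open>Maxima of linear functions\<close>

definition max_lin :: "nat \<Rightarrow> (nat \<Rightarrow> real ^ 'n) \<Rightarrow> real ^ 'n::finite \<Rightarrow> real" where
  "max_lin n b x = Max ((\<lambda>j. b j \<bullet> x) ` {..n})"

text \<open>Ties go to the least index, which makes the choice of an active slope a measurable
  function of the belief.\<close>

definition arg_max_lin :: "nat \<Rightarrow> (nat \<Rightarrow> real ^ 'n) \<Rightarrow> real ^ 'n::finite \<Rightarrow> nat" where
  "arg_max_lin n b x = (LEAST j. j \<le> n \<and> b j \<bullet> x = max_lin n b x)"

lemma max_lin_ge: "j \<le> n \<Longrightarrow> b j \<bullet> x \<le> max_lin n b x"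
  unfolding max_lin_def by (intro Max_ge) auto

lemma arg_max_lin:
  shows "arg_max_lin n b x \<le> n" "b (arg_max_lin n b x) \<bullet> x = max_lin n b x"
proof -
  have "max_lin n b x \<in> (\<lambda>j. b j \<bullet> x) ` {..n}"
    unfolding max_lin_def by (intro Max_in) auto
  then have "\<exists>j. j \<le> n \<and> b j \<bullet> x = max_lin n b x" by auto
  from LeastI_ex[OF this]
  show "arg_max_lin n b x \<le> n" "b (arg_max_lin n b x) \<bullet> x = max_lin n b x"
    unfolding arg_max_lin_def by auto
qed

lemma max_lin_measurable [measurable]: "max_lin n b \<in> borel_measurable borel"
  unfolding max_lin_def by (intro borel_measurable_Max) auto

lemma arg_max_lin_measurable [measurable]: "arg_max_lin n b \<in> borel \<rightarrow>\<^sub>M count_space UNIV"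
  unfolding arg_max_lin_def by measurable

lemma belief_norm_le_1: "x \<in> beliefs \<Longrightarrow> norm x \<le> 1"
  using norm_le_l1_cart[of x] by (simp add: beliefs_def)

lemma abs_max_lin_le:
  assumes "x \<in> beliefs" "\<And>j. j \<le> n \<Longrightarrow> norm (b j) \<le> K"
  shows "\<bar>max_lin n b x\<bar> \<le> K"
proof -
  have "\<bar>max_lin n b x\<bar> \<le> norm (b (arg_max_lin n b x)) * norm x"
    unfolding arg_max_lin(2)[symmetric] by (rule Cauchy_Schwarz_ineq2)
  also have "\<dots> \<le> norm (b (arg_max_lin n b x))"
    using belief_norm_le_1[OF assms(1)] by (simp add: mult_left_le)
  also have "\<dots> \<le> K" by (rule assms(2)[OF arg_max_lin(1)])
  finally show ?thesis .
qed

lemma beliefs_borel [measurable]: "(beliefs :: (real ^ 'n::finite) set) \<in> sets borel"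
proof -
  have "closed ({x. \<forall>\<theta>. 0 \<le> x $ \<theta>} \<inter> {x :: real ^ 'n. (\<Sum>\<theta>\<in>UNIV. x $ \<theta>) = 1})"
    by (intro closed_Int closed_Collect_all closed_Collect_le closed_Collect_eq continuous_intros)
  then show ?thesis
    by (intro borel_closed) (simp add: beliefs_def Collect_conj_eq)
qed

lemma space_belief_space [simp]: "space belief_space = beliefs"
  by (simp add: belief_space_def space_restrict_space)

lemma belief_space_id [measurable]: "(\<lambda>x. x) \<in> belief_space \<rightarrow>\<^sub>M borel"
  unfolding belief_space_def by (rule measurable_restrict_space1) simp

lemma vec_nth_measurable [measurable]: "(\<lambda>x :: real ^ 'n::finite. x $ i) \<in> borel_measurable borel"
  by (intro borel_measurable_continuous_onI continuous_intros)

text \<open>The carrier is the simplex itself, not the ambient space, so pointwise bounds on beliefs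
  hold on the whole space and give integrability at once.\<close>

locale belief_law = prob_space F for F :: "(real ^ 'n::finite) measure" +
  assumes sets_F [measurable_cong]: "sets F = sets belief_space"
begin

lemma space_F: "space F = beliefs"
  using sets_eq_imp_space_eq[OF sets_F] by simp

lemma integrable_bounded_belief:
  fixes f :: "real ^ 'n \<Rightarrow> 'b::{banach, second_countable_topology}"
  assumes [measurable]: "f \<in> borel_measurable belief_space"
    and B: "\<And>x. x \<in> beliefs \<Longrightarrow> norm (f x) \<le> B"
  shows "integrable F f"
  by (rule integrable_const_bound[of _ B])
    (use assms B in \<open>auto simp: space_F intro!: AE_I2\<close>)

lemma integrable_max_lin: "integrable F (max_lin n b)"
  by (rule integrable_bounded_belief[where B = "\<Sum>j\<le>n. norm (b j)"])
    (auto intro!: abs_max_lin_le member_le_sum)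

lemma integrable_scaled_belief:
  assumes [measurable]: "p \<in> borel_measurable belief_space"
    and "\<And>x. x \<in> beliefs \<Longrightarrow> \<bar>p x\<bar> \<le> 1"
  shows "integrable F (\<lambda>x. p x *\<^sub>R x)"
proof (rule integrable_bounded_belief[where B = 1])
  show "norm (p x *\<^sub>R x) \<le> 1" if "x \<in> beliefs" for x
    using mult_mono[OF assms(2)[OF that] belief_norm_le_1[OF that]] by simp
qed measurable

lemma norm_integral_scaled_belief:
  assumes [measurable]: "p \<in> borel_measurable belief_space"
    and "\<And>x. x \<in> beliefs \<Longrightarrow> \<bar>p x\<bar> \<le> 1"
  shows "norm (\<integral>x. p x *\<^sub>R x \<partial>F) \<le> 1"
proof -
  have "norm (p x *\<^sub>R x) \<le> 1" if "x \<in> beliefs" for x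
    using mult_mono[OF assms(2)[OF that] belief_norm_le_1[OF that]] by simp
  then have "(\<integral>x. norm (p x *\<^sub>R x) \<partial>F) \<le> (\<integral>x. 1 \<partial>F)"
    by (intro integral_mono integrable_norm integrable_scaled_belief assms) (auto simp: space_F)
  then show ?thesis
    using integral_norm_bound[of F "\<lambda>x. p x *\<^sub>R x"] by (simp add: prob_space)
qed

text \<open>The cells of \<open>J\<close> are disjoint and cover the beliefs, so at each point one
  summand survives. Slopes paired with cell moments thus become the integral of the linear function
  that \<open>J\<close> selects. This serves both an arbitrary cell map and the argmax.\<close>

lemma sum_cells_inner:
  fixes J :: "real ^ 'n \<Rightarrow> nat"
  assumes [measurable]: "J \<in> belief_space \<rightarrow>\<^sub>M count_space UNIV"
    and J: "\<And>x. x \<in> beliefs \<Longrightarrow> J x \<le> n"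
  shows "(\<Sum>j\<le>n. b j \<bullet> (\<integral>x. of_bool (J x = j) *\<^sub>R x \<partial>F)) = (\<integral>x. b (J x) \<bullet> x \<partial>F)"
proof -
  have i: "integrable F (\<lambda>x. of_bool (J x = j) *\<^sub>R x)" for j
    by (rule integrable_scaled_belief) auto
  have "(\<Sum>j\<le>n. b j \<bullet> (\<integral>x. of_bool (J x = j) *\<^sub>R x \<partial>F)) =
      (\<Sum>j\<le>n. \<integral>x. b j \<bullet> (of_bool (J x = j) *\<^sub>R x) \<partial>F)"
    using i by (intro sum.cong refl integral_inner_right[symmetric]) auto
  also have "\<dots> = (\<integral>x. (\<Sum>j\<le>n. b j \<bullet> (of_bool (J x = j) *\<^sub>R x)) \<partial>F)"
    by (intro Bochner_Integration.integral_sum[symmetric] integrable_inner_right i)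
  also have "\<dots> = (\<integral>x. b (J x) \<bullet> x \<partial>F)"
  proof (rule Bochner_Integration.integral_cong[OF refl])
    fix x assume "x \<in> space F"
    then have "J x \<le> n" using J space_F by auto
    then show "(\<Sum>j\<le>n. b j \<bullet> (of_bool (J x = j) *\<^sub>R x)) = b (J x) \<bullet> x"
      by (simp add: of_bool_def if_distrib[of "\<lambda>c. c *\<^sub>R x"] if_distrib[of "\<lambda>y. _ \<bullet> y"] cong: if_cong)
  qed
  finally show ?thesis .
qed

lemma integrable_cell_inner:
  fixes J :: "real ^ 'n \<Rightarrow> nat"
  assumes [measurable]: "J \<in> belief_space \<rightarrow>\<^sub>M count_space UNIV"
    and J: "\<And>x. x \<in> beliefs \<Longrightarrow> J x \<le> n"
  shows "integrable F (\<lambda>x. b (J x) \<bullet> x)"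
proof (rule integrable_bounded_belief[where B = "\<Sum>j\<le>n. norm (b j)"])
  have [measurable]: "b \<in> count_space UNIV \<rightarrow>\<^sub>M borel" by simp
  show "(\<lambda>x. b (J x) \<bullet> x) \<in> borel_measurable belief_space"
    by measurable
  show "norm (b (J x) \<bullet> x) \<le> (\<Sum>j\<le>n. norm (b j))" if "x \<in> beliefs" for x
  proof -
    have "norm (b (J x) \<bullet> x) \<le> norm (b (J x)) * norm x"
      by (simp add: Cauchy_Schwarz_ineq2)
    also have "\<dots> \<le> norm (b (J x))"
      using belief_norm_le_1[OF that] by (simp add: mult_left_le)
    also have "\<dots> \<le> (\<Sum>j\<le>n. norm (b j))"
      by (rule member_le_sum) (use J[OF that] in auto)
    finally show ?thesis .
  qed
qed

end

text \<open>On beliefs the coordinates sum to 1, so constants are linear functions and the maxima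
  here are those of finitely many affine functions. The relation is therefore the convex order,
  tested on piecewise linear functions.\<close>

definition max_lin_order :: "(real ^ 'n::finite) measure \<Rightarrow> (real ^ 'n) measure \<Rightarrow> bool" where
  "max_lin_order F G \<longleftrightarrow> (\<forall>n b. (\<integral>x. max_lin n b x \<partial>G) \<le> (\<integral>x. max_lin n b x \<partial>F))"

subsection \<open>Strassen's theorem on the simplex\<close>

text \<open>\<open>p j x\<close> is the probability of assigning \<open>x\<close> to cell
  \<open>j\<close>. Randomized assignments, unlike partitions into sets, form a convex family, so a
  segment towards another partition stays inside.\<close>

definition unity_partitions :: "nat \<Rightarrow> (nat \<Rightarrow> real ^ 'n::finite \<Rightarrow> real) set" where
  "unity_partitions n = {p. (\<forall>j. p j \<in> borel_measurable belief_space) \<and>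
     (\<forall>j x. 0 \<le> p j x) \<and> (\<forall>x. (\<Sum>j\<le>n. p j x) = 1)}"

lemma unity_partitions_le_1:
  assumes "p \<in> unity_partitions n" "j \<le> n"
  shows "\<bar>p j x\<bar> \<le> 1"
  using assms member_le_sum[of j "{..n}" "\<lambda>j. p j x"] by (auto simp: unity_partitions_def)

text \<open>For a partition of unity, replaced by the argmax cells of the linear functions with slopes
  \<open>z j\<close> minus the current moments, the squared distance to the target \<open>z\<close> drops to first order by
  at least twice itself. Hence its infimum is zero.\<close>

lemma approximate_split:
  fixes F G :: "(real ^ 'n::finite) measure"
  assumes "belief_law F" "belief_law G" and ord: "max_lin_order F G"
    and J [measurable]: "J \<in> belief_space \<rightarrow>\<^sub>M count_space UNIV"
    and Jn: "\<And>x. x \<in> beliefs \<Longrightarrow> J x \<le> n"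
    and "\<epsilon> > 0"
  obtains p where "p \<in> unity_partitions n"
    and "\<And>j. j \<le> n \<Longrightarrow>
      norm ((\<integral>x. p j x *\<^sub>R x \<partial>F) - (\<integral>y. of_bool (J y = j) *\<^sub>R y \<partial>G)) \<le> \<epsilon>"
proof -
  interpret F: belief_law F by fact
  interpret G: belief_law G by fact
  define z where "z j = (\<integral>y. of_bool (J y = j) *\<^sub>R y \<partial>G)" for j
  define m where "m p j = (\<integral>x. p j x *\<^sub>R x \<partial>F)" for p :: "nat \<Rightarrow> real ^ 'n \<Rightarrow> real" and j
  define \<Phi> where "\<Phi> p = (\<Sum>j\<le>n. (norm (z j - m p j))\<^sup>2)" for p
  define D where "D = Inf (\<Phi> ` unity_partitions n)"
  \<comment> \<open>Moments have norm at most 1, so a difference of two of them has norm at most 2;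
    \<open>R\<close> bounds the sum of the squared differences and hence the second-order term of
    the descent.\<close>
  define R where "R = (\<Sum>j\<le>n. 4 :: real)"
  have \<Phi>0: "0 \<le> \<Phi> p" for p
    unfolding \<Phi>_def by (intro sum_nonneg) auto
  have bb: "bdd_below (\<Phi> ` unity_partitions n)"
    by (rule bdd_belowI[of _ 0]) (use \<Phi>0 in auto)
  have ne: "unity_partitions n \<noteq> ({} :: (nat \<Rightarrow> real ^ 'n \<Rightarrow> real) set)"
  proof -
    have "(\<lambda>j x. of_bool (j = 0)) \<in> unity_partitions n"
      by (auto simp: unity_partitions_def)
    then show ?thesis by blast
  qed
  have meas: "p j \<in> borel_measurable belief_space" if "p \<in> unity_partitions n" for p j
    using that by (auto simp: unity_partitions_def)
  have intp: "integrable F (\<lambda>x. p j x *\<^sub>R x)" if "p \<in> unity_partitions n" "j \<le> n" for p j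
    by (intro F.integrable_scaled_belief meas[OF that(1)] unity_partitions_le_1[OF that])
  have m1: "norm (m p j) \<le> 1" if "p \<in> unity_partitions n" "j \<le> n" for p j
    unfolding m_def
    by (intro F.norm_integral_scaled_belief meas[OF that(1)] unity_partitions_le_1[OF that])
  have descent: "D \<le> (1 - 2 * t) * \<Phi> p + t\<^sup>2 * R"
    if p: "p \<in> unity_partitions n" and t: "0 \<le> t" "t \<le> 1" for p t
  proof -
    define b where "b j = z j - m p j" for j
    define p' :: "nat \<Rightarrow> real ^ 'n \<Rightarrow> real" where "p' j x = of_bool (arg_max_lin n b x = j)" for j x
    have p': "p' \<in> unity_partitions n"
      unfolding unity_partitions_def
    proof (intro CollectI conjI allI)
      show "p' j \<in> borel_measurable belief_space" for j
        unfolding p'_def by measurable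
      show "(\<Sum>j\<le>n. p' j x) = 1" for x
        using arg_max_lin(1)[of n b x] by (simp add: p'_def of_bool_def)
    qed (auto simp: p'_def)
    define d where "d j = m p' j - m p j" for j
    \<comment> \<open>For the slopes \<open>b\<close>, the cells \<open>J\<close> do no better on
      \<open>G\<close> than the argmax cells, and the order carries the resulting maximum over to
      \<open>F\<close>, where \<open>p'\<close> attains it.\<close>
    have "(\<Sum>j\<le>n. b j \<bullet> z j) = (\<integral>x. b (J x) \<bullet> x \<partial>G)"
      unfolding z_def by (rule G.sum_cells_inner[OF J Jn])
    also have "\<dots> \<le> (\<integral>x. max_lin n b x \<partial>G)"
      by (intro integral_mono G.integrable_cell_inner[OF J Jn] G.integrable_max_lin)
        (auto intro!: max_lin_ge Jn simp: G.space_F)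
    also have "\<dots> \<le> (\<integral>x. max_lin n b x \<partial>F)"
      using ord by (simp add: max_lin_order_def)
    also have "\<dots> = (\<integral>x. b (arg_max_lin n b x) \<bullet> x \<partial>F)"
      by (simp add: arg_max_lin(2))
    also have "\<dots> = (\<Sum>j\<le>n. b j \<bullet> m p' j)"
      unfolding m_def p'_def
      by (rule F.sum_cells_inner[symmetric]) (auto intro: arg_max_lin(1))
    finally have "0 \<le> (\<Sum>j\<le>n. b j \<bullet> m p' j) - (\<Sum>j\<le>n. b j \<bullet> z j)" by simp
    also have "\<dots> = (\<Sum>j\<le>n. b j \<bullet> d j) - \<Phi> p"
      unfolding \<Phi>_def sum_subtractf[symmetric]
      by (intro sum.cong refl)
        (simp add: d_def b_def power2_norm_eq_inner inner_diff_right inner_diff_left algebra_simps)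
    finally have up: "\<Phi> p \<le> (\<Sum>j\<le>n. b j \<bullet> d j)" by simp
    define q where "q j x = (1 - t) * p j x + t * p' j x" for j x
    have q: "q \<in> unity_partitions n"
      using p p' t meas[OF p] meas[OF p'] unfolding unity_partitions_def q_def
      by (auto simp: sum.distrib sum_distrib_left[symmetric]
          intro!: borel_measurable_add borel_measurable_times borel_measurable_const)
    have mq: "m q j = m p j + t *\<^sub>R d j" if "j \<le> n" for j
    proof -
      have "m q j = (\<integral>x. (1 - t) *\<^sub>R (p j x *\<^sub>R x) + t *\<^sub>R (p' j x *\<^sub>R x) \<partial>F)"
        unfolding m_def q_def by (simp add: algebra_simps)
      also have "\<dots> = (1 - t) *\<^sub>R m p j + t *\<^sub>R m p' j"
        unfolding m_def using intp[OF p that] intp[OF p' that] by (simp del: scaleR_scaleR)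
      finally show ?thesis unfolding d_def by (simp add: algebra_simps)
    qed
    have "\<Phi> q = (\<Sum>j\<le>n. (norm (b j))\<^sup>2 - 2 * t * (b j \<bullet> d j) + t\<^sup>2 * (norm (d j))\<^sup>2)"
      unfolding \<Phi>_def
    proof (intro sum.cong refl)
      fix j assume "j \<in> {..n}"
      then have eq: "z j - m q j = b j - t *\<^sub>R d j" by (simp add: mq b_def)
      show "(norm (z j - m q j))\<^sup>2 = (norm (b j))\<^sup>2 - 2 * t * (b j \<bullet> d j) + t\<^sup>2 * (norm (d j))\<^sup>2"
        unfolding eq power2_norm_eq_inner
        by (simp add: inner_diff_right inner_diff_left inner_commute algebra_simps power2_eq_square)
    qed
    also have "\<dots> = \<Phi> p - 2 * t * (\<Sum>j\<le>n. b j \<bullet> d j) + t\<^sup>2 * (\<Sum>j\<le>n. (norm (d j))\<^sup>2)"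
      by (simp add: sum.distrib sum_subtractf sum_distrib_left \<Phi>_def b_def)
    also have "\<dots> \<le> \<Phi> p - 2 * t * \<Phi> p + t\<^sup>2 * R"
    proof (intro add_mono diff_mono order_refl mult_left_mono up)
      show "(\<Sum>j\<le>n. (norm (d j))\<^sup>2) \<le> R"
        unfolding R_def
      proof (rule sum_mono)
        fix j assume "j \<in> {..n}"
        then have "norm (d j) \<le> 2"
          unfolding d_def using norm_triangle_ineq4[of "m p' j" "m p j"] m1[OF p, of j] m1[OF p', of j]
          by simp
        then show "(norm (d j))\<^sup>2 \<le> 4"
          using power_mono[of "norm (d j)" 2 2] by simp
      qed
    qed (use t in auto)
    also have "\<dots> = (1 - 2 * t) * \<Phi> p + t\<^sup>2 * R" by (simp add: algebra_simps)
    finally show ?thesis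
      using cInf_lower[OF _ bb, of "\<Phi> q"] q unfolding D_def by auto
  qed
  have "D \<le> 0"
  proof (rule ccontr)
    assume "\<not> D \<le> 0"
    have "R > 0" unfolding R_def by simp
    \<comment> \<open>Taking the infimum over \<open>p\<close> in \<open>descent\<close> gives
      \<open>2 * D \<le> t * R\<close>, which fails for \<open>t \<le> D / R\<close> if
      \<open>D\<close> is positive. The bound 1/4 keeps the divisor \<open>1 - 2 * t\<close>
      positive.\<close>
    define t where "t = min (1/4) (D / R)"
    have t: "0 < t" "t \<le> 1/4" "t * R \<le> D"
      using \<open>\<not> D \<le> 0\<close> \<open>R > 0\<close> unfolding t_def by (auto simp: min_def field_simps)
    have "(D - t\<^sup>2 * R) / (1 - 2 * t) \<le> D"
      unfolding D_def
    proof (rule cInf_greatest)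
      show "\<Phi> ` unity_partitions n \<noteq> {}" using ne by simp
      show "(Inf (\<Phi> ` unity_partitions n) - t\<^sup>2 * R) / (1 - 2 * t) \<le> y"
        if "y \<in> \<Phi> ` unity_partitions n" for y
        using descent[of _ t] that t unfolding D_def by (auto simp: field_simps)
    qed
    then have "2 * t * D \<le> t * (t * R)"
      using t by (simp add: field_simps power2_eq_square)
    then have "2 * D \<le> t * R"
      using t by simp
    then show False using t \<open>\<not> D \<le> 0\<close> by linarith
  qed
  then have "D < \<epsilon>\<^sup>2" using \<open>\<epsilon> > 0\<close> by (smt (verit) zero_less_power)
  then obtain p where p: "p \<in> unity_partitions n" "\<Phi> p < \<epsilon>\<^sup>2"
    using cInf_lessD[of "\<Phi> ` unity_partitions n"] ne unfolding D_def by auto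
  show thesis
  proof
    show "norm ((\<integral>x. p j x *\<^sub>R x \<partial>F) - (\<integral>y. of_bool (J y = j) *\<^sub>R y \<partial>G)) \<le> \<epsilon>" if "j \<le> n" for j
    proof -
      have "(norm (z j - m p j))\<^sup>2 \<le> \<Phi> p"
        unfolding \<Phi>_def by (rule member_le_sum) (use that in auto)
      then have "(norm (z j - m p j))\<^sup>2 \<le> \<epsilon>\<^sup>2" using p(2) by simp
      then have "norm (z j - m p j) \<le> \<epsilon>"
        using \<open>\<epsilon> > 0\<close> power2_le_imp_le by fastforce
      then show ?thesis unfolding z_def m_def by (simp add: norm_minus_commute)
    qed
  qed fact
qed

text \<open>By the parallelogram law, elements of \<open>C n\<close> with nearly minimal \<open>L\<^sup>2\<close> norm form a Cauchy
  sequence. This stands in for weak compactness.\<close>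

lemma (in prob_space) midconvex_AE_convergent:
  fixes C :: "nat \<Rightarrow> ('a \<Rightarrow> real) set"
  assumes dec: "decseq C"
    and ne: "\<And>n. C n \<noteq> {}"
    and meas: "\<And>n f. f \<in> C n \<Longrightarrow> f \<in> borel_measurable M"
    and bnd: "\<And>n f x. f \<in> C n \<Longrightarrow> \<bar>f x\<bar> \<le> 1"
    and mid: "\<And>n f g. f \<in> C n \<Longrightarrow> g \<in> C n \<Longrightarrow> (\<lambda>x. (f x + g x) / 2) \<in> C n"
  obtains s where "\<And>n. s n \<in> C n" "AE x in M. convergent (\<lambda>n. s n x)"
proof -
  define N where "N f = (\<integral>x. (f x)\<^sup>2 \<partial>M)" for f :: "'a \<Rightarrow> real"
  define c where "c n = Inf (N ` C n)" for n
  have sq1: "(f x)\<^sup>2 \<le> 1" if "f \<in> C n" for f n x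
    using bnd[OF that, of x] by (simp add: abs_square_le_1)
  have int2: "integrable M (\<lambda>x. (f x)\<^sup>2)" if "f \<in> C n" for f n
    by (rule integrable_const_bound[of _ 1]) (use that sq1 meas in auto)
  have intf: "integrable M f" if "f \<in> C n" for f n
    by (rule integrable_const_bound[of _ 1]) (use that bnd meas in auto)
  have N01: "0 \<le> N f" "f \<in> C n \<Longrightarrow> N f \<le> 1" for f n
    subgoal unfolding N_def by simp
    subgoal unfolding N_def using integral_mono[OF int2, of f n "\<lambda>_. 1"] sq1 by (simp add: prob_space)
    done
  have bb: "bdd_below (N ` C n)" for n
    by (rule bdd_belowI[of _ 0]) (use N01 in auto)
  have "\<exists>f. f \<in> C n \<and> N f < c n + 1 / Suc n" for n
    using cInf_lessD[of "N ` C n" "c n + 1 / Suc n"] ne[of n] unfolding c_def by auto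
  then obtain f where f: "\<And>n. f n \<in> C n" "\<And>n. N (f n) < c n + 1 / Suc n"
    by metis
  have cle: "c n \<le> N g" if "g \<in> C n" for g n
    unfolding c_def by (rule cInf_lower[OF _ bb]) (use that in auto)
  \<comment> \<open>Smaller sets have larger infima. Convergence of \<open>c\<close> is what makes
    the parallelogram bound in \<open>key\<close> small.\<close>
  have "incseq c"
    unfolding incseq_def c_def
    by (intro allI impI cInf_superset_mono bb image_mono) (use ne dec in \<open>simp_all add: decseq_def\<close>)
  moreover have "c n \<le> 1" for n
    using cle[OF f(1)] N01(2)[OF f(1)] order_trans by blast
  ultimately have "convergent c"
    unfolding convergent_def by (meson incseq_convergent)
  then have "Cauchy c" by (rule convergent_Cauchy)
  have key: "(\<integral>x. (f m x - f n x)\<^sup>2 \<partial>M) \<le> 2 * (c m - c n) + 4 / Suc n" if "n \<le> m" for m n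
  proof -
    have fm: "f m \<in> C n" using dec f(1)[of m] that by (auto simp: decseq_def)
    let ?g = "\<lambda>x. (f m x + f n x) / 2"
    have g: "?g \<in> C n" by (rule mid[OF fm f(1)])
    have "(\<integral>x. (f m x - f n x)\<^sup>2 \<partial>M) = (\<integral>x. 2 * (f m x)\<^sup>2 + 2 * (f n x)\<^sup>2 - 4 * (?g x)\<^sup>2 \<partial>M)"
      by (rule Bochner_Integration.integral_cong) (auto simp: power2_eq_square algebra_simps)
    also have "\<dots> = 2 * N (f m) + 2 * N (f n) - 4 * N ?g"
      unfolding N_def using int2[OF fm] int2[OF f(1)[of n]] int2[OF g] by simp
    also have "\<dots> \<le> 2 * (c m + 1 / Suc m) + 2 * (c n + 1 / Suc n) - 4 * c n"
      by (intro diff_mono add_mono mult_left_mono less_imp_le[OF f(2)] cle[OF g]) auto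
    also have "\<dots> \<le> 2 * (c m - c n) + 4 / Suc n"
    proof -
      have "1 / real (Suc m) \<le> 1 / Suc n" using that by (simp add: frac_le)
      then show ?thesis by argo
    qed
    finally show ?thesis .
  qed
  have half: "\<exists>K. \<forall>n\<ge>K. \<forall>m\<ge>n. (\<integral>x. norm (f m x - f n x) \<partial>M) < e" if "e > 0" for e
  proof -
    \<comment> \<open>With these thresholds the two terms of the bound in \<open>key\<close> are
      each below \<open>e\<^sup>2 / 2\<close>.\<close>
    obtain K1 where K1: "\<And>m n. m \<ge> K1 \<Longrightarrow> n \<ge> K1 \<Longrightarrow> \<bar>c m - c n\<bar> < e\<^sup>2 / 4"
      using CauchyD[OF \<open>Cauchy c\<close>, of "e\<^sup>2 / 4"] \<open>e > 0\<close> by auto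
    obtain K2 where K2: "1 / Suc K2 < e\<^sup>2 / 8"
      using nat_approx_posE[of "e\<^sup>2/8"] \<open>e > 0\<close> by auto
    show ?thesis
    proof (intro exI[of _ "max K1 K2"] allI impI)
      fix n m assume nm: "n \<ge> max K1 K2" "m \<ge> n"
      have "1 / real (Suc n) \<le> 1 / Suc K2" using nm by (simp add: frac_le)
      then have "4 / real (Suc n) < e\<^sup>2 / 2" using K2 by simp
      moreover have "c m - c n < e\<^sup>2 / 4" by (rule le_less_trans[OF abs_ge_self K1]) (use nm in auto)
      ultimately have lt: "(\<integral>x. (f m x - f n x)\<^sup>2 \<partial>M) < e\<^sup>2"
        using key[OF nm(2)] by argo
      have bnd4: "(f m x - f n x)\<^sup>2 \<le> 4" for x
      proof -
        have "\<bar>f m x - f n x\<bar> \<le> 2"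
          using abs_triangle_ineq4[of "f m x" "f n x"] bnd[OF f(1), of m x] bnd[OF f(1), of n x]
          by linarith
        then show ?thesis using abs_le_square_iff[of "f m x - f n x" 2] by simp
      qed
      have i: "integrable M (\<lambda>x. (f m x - f n x)\<^sup>2)"
        by (rule integrable_const_bound[of _ 4])
          (use meas[OF f(1)] bnd4 in auto)
      \<comment> \<open>Young's inequality passes from the \<open>L\<^sup>2\<close> bound to
        \<open>L\<^sup>1\<close>, the norm in which almost everywhere convergent subsequences are
        extracted. The weights turn a squared distance below \<open>e\<^sup>2\<close> into
        \<open>e / 2 + e / 2\<close>.\<close>
      have pt: "norm (f m x - f n x) \<le> e / 2 + (f m x - f n x)\<^sup>2 / (2 * e)" for x
      proof -
        have "0 \<le> (\<bar>f m x - f n x\<bar> - e)\<^sup>2" by simp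
        then have "2 * e * \<bar>f m x - f n x\<bar> \<le> e\<^sup>2 + (f m x - f n x)\<^sup>2"
          by (simp add: power2_diff mult.commute mult.left_commute)
        then show ?thesis using \<open>e > 0\<close> by (simp add: field_simps power2_eq_square)
      qed
      have "(\<integral>x. norm (f m x - f n x) \<partial>M) \<le> (\<integral>x. e / 2 + (f m x - f n x)\<^sup>2 / (2 * e) \<partial>M)"
        by (rule integral_mono) (use pt i intf[OF f(1)] in auto)
      also have "\<dots> = e / 2 + (\<integral>x. (f m x - f n x)\<^sup>2 \<partial>M) / (2 * e)"
        using i by (simp add: prob_space)
      also have "\<dots> < e"
        using lt \<open>e > 0\<close> by (simp add: field_simps power2_eq_square)
      finally show "(\<integral>x. norm (f m x - f n x) \<partial>M) < e" .
    qed
  qed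
  have "\<exists>K. \<forall>i\<ge>K. \<forall>j\<ge>K. (\<integral>x. norm (f i x - f j x) \<partial>M) < e" if e0: "e > 0" for e
  proof -
    obtain K where K: "\<And>n m. n \<ge> K \<Longrightarrow> m \<ge> n \<Longrightarrow> (\<integral>x. norm (f m x - f n x) \<partial>M) < e"
      using half[OF e0] by blast
    show ?thesis
    proof (intro exI[of _ K] allI impI)
      fix i j assume "K \<le> i" "K \<le> j"
      then show "(\<integral>x. norm (f i x - f j x) \<partial>M) < e"
        using K[of i j] K[of j i] by (cases i j rule: le_cases) (auto simp: abs_minus_commute)
    qed
  qed
  with cauchy_L1_AE_cauchy_subseq[of M f] intf[OF f(1)]
  obtain r where r: "strict_mono r" "AE x in M. Cauchy (\<lambda>i. f (r i) x)"
    by blast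
  show thesis
  proof
    show "f (r n) \<in> C n" for n
      using f(1)[of "r n"] dec strict_mono_imp_increasing[OF r(1), of n] by (auto simp: decseq_def)
    show "AE x in M. convergent (\<lambda>n. f (r n) x)"
      using r(2) by (simp add: Cauchy_convergent_iff)
  qed
qed

text \<open>The functions \<open>h k\<close> play the role of \<open>P(c Y \<ge> \<rho> k | X)\<close> in a martingale coupling \<open>(X, Y)\<close>.\<close>

lemma survival_kernel:
  fixes F G :: "(real ^ 'n::finite) measure" and \<rho> :: "nat \<Rightarrow> real"
    and c :: "real ^ 'n \<Rightarrow> real"
  assumes "belief_law F" "belief_law G" and ord: "max_lin_order F G"
    and c [measurable]: "c \<in> borel_measurable borel"
  obtains h :: "nat \<Rightarrow> real ^ 'n \<Rightarrow> real"
  where "\<And>k. h k \<in> borel_measurable F"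
    and "AE x in F. \<forall>k. h k x \<in> {0..1}"
    and "AE x in F. \<forall>i j. \<rho> i \<le> \<rho> j \<longrightarrow> h j x \<le> h i x"
    and "\<And>k. (\<integral>x. h k x *\<^sub>R x \<partial>F) = (\<integral>y. of_bool (\<rho> k \<le> c y) *\<^sub>R y \<partial>G)"
proof -
  interpret F: belief_law F by fact
  interpret G: belief_law G by fact
  \<comment> \<open>A probability on the indices merges the countably many unknown functions into
    one function on a product space, so that a single minimization treats them all. The geometric
    law charges every index, hence convergence for almost every \<open>k\<close> is convergence for
    every \<open>k\<close>.\<close>
  define P :: "nat measure" where "P = measure_pmf (geometric_pmf (1/2))"
  interpret P: prob_space P unfolding P_def by (rule prob_space_measure_pmf)
  interpret PF: pair_prob_space P F ..
  have sets_P: "sets P = sets (count_space UNIV)" by (simp add: P_def)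
  define w where "w k = (\<integral>y. of_bool (\<rho> k \<le> c y) *\<^sub>R y \<partial>G)" for k
  \<comment> \<open>Stage \<open>n\<close> imposes monotonicity and moments only on thresholds with
    index up to \<open>n\<close>, and the moments only up to \<open>1 / Suc n\<close>. Hence the
    sets decrease, and midpoints preserve every requirement.\<close>
  define C where "C n = {f :: nat \<times> (real ^ 'n) \<Rightarrow> real.
      (\<forall>k. (\<lambda>x. f (k, x)) \<in> borel_measurable F) \<and>
      (\<forall>k x. f (k, x) \<in> {0..1}) \<and>
      (\<forall>i\<le>n. \<forall>j\<le>n. \<rho> i \<le> \<rho> j \<longrightarrow> (\<forall>x. f (j, x) \<le> f (i, x))) \<and>
      (\<forall>k\<le>n. norm ((\<integral>x. f (k, x) *\<^sub>R x \<partial>F) - w k) \<le> 1 / Suc n)}" for n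
  have int: "integrable F (\<lambda>x. f (k, x) *\<^sub>R x)" if "f \<in> C n" for f n k
    by (rule F.integrable_scaled_belief)
      (use that in \<open>auto simp: C_def measurable_cong_sets[OF F.sets_F refl]\<close>)
  have ne: "C n \<noteq> {}" for n
  proof -
    \<comment> \<open>The rank of \<open>z\<close> among the first \<open>n + 1\<close> thresholds,
      a number from 0 to \<open>Suc n\<close>. By \<open>J_iff\<close> each event
      \<open>\<rho> k \<le> z\<close> is the union of the cells of rank at least
      \<open>J (\<rho> k)\<close>, even if thresholds coincide.\<close>
    define J where "J z = card {i. i \<le> n \<and> \<rho> i \<le> z}" for z
    have fin: "finite {i. i \<le> n \<and> Q i}" for Q by simp
    have J_le: "J z \<le> Suc n" for z
      unfolding J_def using card_mono[of "{..n}" "{i. i \<le> n \<and> \<rho> i \<le> z}"] by auto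
    have J_mono: "J a \<le> J b" if "a \<le> b" for a b
      unfolding J_def by (rule card_mono) (use that in auto)
    have J_iff: "\<rho> k \<le> z \<longleftrightarrow> J (\<rho> k) \<le> J z" if "k \<le> n" for k z
    proof
      assume "J (\<rho> k) \<le> J z"
      show "\<rho> k \<le> z"
      proof (rule ccontr)
        assume "\<not> \<rho> k \<le> z"
        then have "{i. i \<le> n \<and> \<rho> i \<le> z} \<subset> {i. i \<le> n \<and> \<rho> i \<le> \<rho> k}"
          using that by auto
        then have "J z < J (\<rho> k)" unfolding J_def by (rule psubset_card_mono[rotated]) simp
        then show False using \<open>J (\<rho> k) \<le> J z\<close> by simp
      qed
    qed (rule J_mono)
    have J_sum: "J z = (\<Sum>i\<le>n. of_bool (\<rho> i \<le> z))" for z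
      unfolding J_def by (simp add: of_bool_def sum.If_cases Int_def)
    have J_meas: "(\<lambda>y. J (c y)) \<in> belief_space \<rightarrow>\<^sub>M count_space UNIV"
      unfolding J_sum by measurable
    \<comment> \<open>A threshold event consists of at most \<open>n + 2\<close> cells; an error
      \<open>e\<close> on each adds up to at most \<open>1 / Suc n\<close>.\<close>
    define e where "e = 1 / (real (Suc n) * real (Suc (Suc n)))"
    have "e > 0" unfolding e_def by simp
    obtain p where p: "p \<in> unity_partitions (Suc n)"
      and pe: "\<And>j. j \<le> Suc n \<Longrightarrow>
        norm ((\<integral>x. p j x *\<^sub>R x \<partial>F) - (\<integral>y. of_bool (J (c y) = j) *\<^sub>R y \<partial>G)) \<le> e"
      using approximate_split[OF assms(1,2) ord J_meas J_le \<open>e > 0\<close>] by blast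
    \<comment> \<open>The value is the total weight of the cells at or above the rank of
      \<open>\<rho> k\<close>. For \<open>k > n\<close> only measurability and the range are
      demanded, so 0 will do.\<close>
    define f where "f = (\<lambda>(k, x). if k \<le> n then \<Sum>j\<in>{J (\<rho> k)..Suc n}. p j x else 0)"
    have p0: "0 \<le> p j x" for j x using p by (simp add: unity_partitions_def)
    have psum: "(\<Sum>j\<le>Suc n. p j x) = 1" for x using p by (simp add: unity_partitions_def)
    have pm: "p j \<in> borel_measurable belief_space" for j using p by (simp add: unity_partitions_def)
    have ip: "integrable F (\<lambda>x. p j x *\<^sub>R x)" if "j \<le> Suc n" for j
      by (intro F.integrable_scaled_belief pm unity_partitions_le_1[OF p that])
    have iJ: "integrable G (\<lambda>y. of_bool (J (c y) = j) *\<^sub>R y)" for j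
      by (rule G.integrable_scaled_belief) (use J_meas in auto)
    have "f \<in> C n"
      unfolding C_def
    proof (intro CollectI conjI allI impI)
      show "(\<lambda>x. f (k, x)) \<in> borel_measurable F" for k
        using pm unfolding f_def measurable_cong_sets[OF F.sets_F refl] by auto
      have "(\<Sum>j\<in>{J (\<rho> k)..Suc n}. p j x) \<le> 1" for k x
        using sum_mono2[of "{..Suc n}" "{J (\<rho> k)..Suc n}" "\<lambda>j. p j x"] psum p0 by auto
      then show "f (k, x) \<in> {0..1}" for k x
        unfolding f_def by (auto simp del: sum.cl_ivl_Suc intro!: sum_nonneg p0)
      show "f (j, x) \<le> f (i, x)" if "i \<le> n" "j \<le> n" "\<rho> i \<le> \<rho> j" for i j x
        unfolding f_def using that J_mono[OF that(3)]
        by (auto simp del: sum.cl_ivl_Suc intro!: sum_mono2 p0)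
      show "norm ((\<integral>x. f (k, x) *\<^sub>R x \<partial>F) - w k) \<le> 1 / Suc n" if "k \<le> n" for k
      proof -
        let ?I = "{J (\<rho> k)..Suc n}"
        have "(\<integral>x. f (k, x) *\<^sub>R x \<partial>F) = (\<Sum>j\<in>?I. \<integral>x. p j x *\<^sub>R x \<partial>F)"
          using that ip unfolding f_def by (simp add: scaleR_sum_left del: sum.cl_ivl_Suc)
        moreover have "w k = (\<Sum>j\<in>?I. \<integral>y. of_bool (J (c y) = j) *\<^sub>R y \<partial>G)"
        proof -
          have "of_bool (\<rho> k \<le> c y) *\<^sub>R y = (\<Sum>j\<in>?I. of_bool (J (c y) = j) *\<^sub>R y)" for y
            using J_iff[OF that, of "c y"] J_le[of "c y"]
            by (simp add: scaleR_sum_left[symmetric] of_bool_def del: sum.cl_ivl_Suc)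
          then show ?thesis
            unfolding w_def using iJ by (simp del: sum.cl_ivl_Suc)
        qed
        ultimately have "norm ((\<integral>x. f (k, x) *\<^sub>R x \<partial>F) - w k) \<le>
            (\<Sum>j\<in>?I. norm ((\<integral>x. p j x *\<^sub>R x \<partial>F) - (\<integral>y. of_bool (J (c y) = j) *\<^sub>R y \<partial>G)))"
          by (simp only: sum_subtractf[symmetric] norm_sum)
        also have "\<dots> \<le> (\<Sum>j\<in>?I. e)"
          by (rule sum_mono) (use pe in auto)
        also have "\<dots> \<le> real (Suc (Suc n)) * e"
          using \<open>e > 0\<close> by (simp del: of_nat_Suc sum.cl_ivl_Suc)
        also have "\<dots> = 1 / Suc n" unfolding e_def by (simp del: of_nat_Suc)
        finally show ?thesis .
      qed
    qed
    then show ?thesis by blast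
  qed
  have dec: "decseq C"
  proof (rule decseq_SucI, rule subsetI)
    fix n f assume f: "f \<in> C (Suc n)"
    have "1 / real (Suc (Suc n)) \<le> 1 / Suc n" by (simp add: frac_le)
    then show "f \<in> C n"
      using f order_trans[OF _ \<open>1 / real (Suc (Suc n)) \<le> 1 / Suc n\<close>] unfolding C_def
      by (simp del: of_nat_Suc)
  qed
  have meas: "f \<in> borel_measurable (P \<Otimes>\<^sub>M F)" if "f \<in> C n" for f n
    unfolding measurable_cong_sets[OF sets_pair_measure_cong[OF sets_P refl] refl]
    by (rule measurable_pair_measure_countable1) (use that in \<open>auto simp: C_def\<close>)
  have bnd: "\<bar>f y\<bar> \<le> 1" if "f \<in> C n" for f n y
    using that by (cases y) (simp add: C_def)
  have mid: "(\<lambda>x. (f x + g x) / 2) \<in> C n" if f: "f \<in> C n" and g: "g \<in> C n" for f g n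
    unfolding C_def
  proof (intro CollectI conjI allI impI)
    show "(\<lambda>x. (f (k, x) + g (k, x)) / 2) \<in> borel_measurable F" for k
    proof -
      have [measurable]: "(\<lambda>x. f (k, x)) \<in> borel_measurable F" "(\<lambda>x. g (k, x)) \<in> borel_measurable F"
        using f g by (simp_all add: C_def)
      show ?thesis by measurable
    qed
    show "(f (k, x) + g (k, x)) / 2 \<in> {0..1}" for k x
    proof -
      have "0 \<le> f (k, x)" "f (k, x) \<le> 1" "0 \<le> g (k, x)" "g (k, x) \<le> 1"
        using f g by (simp_all add: C_def)
      then show ?thesis by simp
    qed
    show "(f (j, x) + g (j, x)) / 2 \<le> (f (i, x) + g (i, x)) / 2"
      if "i \<le> n" "j \<le> n" "\<rho> i \<le> \<rho> j" for i j x
      using f g that by (auto simp: C_def intro!: divide_right_mono add_mono)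
    show "norm ((\<integral>x. ((f (k, x) + g (k, x)) / 2) *\<^sub>R x \<partial>F) - w k) \<le> 1 / Suc n" if "k \<le> n" for k
    proof -
      let ?f = "\<integral>x. f (k, x) *\<^sub>R x \<partial>F" and ?g = "\<integral>x. g (k, x) *\<^sub>R x \<partial>F"
      have "(\<integral>x. ((f (k, x) + g (k, x)) / 2) *\<^sub>R x \<partial>F) =
          (\<integral>x. (1/2) *\<^sub>R (f (k, x) *\<^sub>R x + g (k, x) *\<^sub>R x) \<partial>F)"
        by (simp add: scaleR_add_left[symmetric])
      also have "\<dots> = (1/2) *\<^sub>R (?f + ?g)"
        using int[OF f] int[OF g] by simp
      finally have "(\<integral>x. ((f (k, x) + g (k, x)) / 2) *\<^sub>R x \<partial>F) - w k =
          (1/2) *\<^sub>R ((?f - w k) + (?g - w k))"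
        by (simp add: algebra_simps scaleR_2[symmetric])
      then have "norm ((\<integral>x. ((f (k, x) + g (k, x)) / 2) *\<^sub>R x \<partial>F) - w k) \<le>
          (norm (?f - w k) + norm (?g - w k)) / 2"
        using norm_triangle_ineq[of "?f - w k" "?g - w k"] by simp
      moreover have "norm (?f - w k) \<le> 1 / Suc n" "norm (?g - w k) \<le> 1 / Suc n"
        using f g that by (auto simp: C_def)
      ultimately show ?thesis by argo
    qed
  qed
  have "\<exists>s. (\<forall>n. s n \<in> C n) \<and> (AE x in P \<Otimes>\<^sub>M F. convergent (\<lambda>n. s n x))"
  proof (rule PF.midconvex_AE_convergent[of C, OF dec ne meas])
    show "\<bar>f y\<bar> \<le> 1" if "f \<in> C n" for n f y
      by (rule bnd[OF that])
    show "(\<lambda>x. (f x + g x) / 2) \<in> C n" if "f \<in> C n" "g \<in> C n" for n f g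
      by (rule mid[OF that])
    show "\<exists>s. (\<forall>n. s n \<in> C n) \<and> (AE x in P \<Otimes>\<^sub>M F. convergent (\<lambda>n. s n x))"
      if "\<And>n. s n \<in> C n" "AE x in P \<Otimes>\<^sub>M F. convergent (\<lambda>n. s n x)" for s
      using that by (intro exI[of _ s]) simp
  qed
  then obtain s where s: "\<And>n. s n \<in> C n"
    and conv: "AE x in P \<Otimes>\<^sub>M F. convergent (\<lambda>n. s n x)"
    by auto
  have "AE k in P. AE x in F. convergent (\<lambda>n. s n (k, x))"
    by (rule PF.AE_pair[OF conv])
  then have "AE x in F. convergent (\<lambda>n. s n (k, x))" for k
    unfolding P_def AE_measure_pmf_iff by (simp add: set_pmf_geometric)
  then have conv_all: "AE x in F. \<forall>k. convergent (\<lambda>n. s n (k, x))"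
    by (simp add: AE_all_countable)
  define h where "h k x = lim (\<lambda>n. s n (k, x))" for k x
  have lim: "AE x in F. \<forall>k. (\<lambda>n. s n (k, x)) \<longlonglongrightarrow> h k x"
    using conv_all unfolding h_def by (auto simp: convergent_LIMSEQ_iff)
  have sm [measurable]: "(\<lambda>x. s n (k, x)) \<in> borel_measurable F" for n k
    using s[of n] by (simp add: C_def)
  have s01: "s n (k, x) \<in> {0..1}" for n k x
    using s[of n] by (simp add: C_def)
  have smono: "s n (j, x) \<le> s n (i, x)" if "i \<le> n" "j \<le> n" "\<rho> i \<le> \<rho> j" for n i j x
    using s[of n] that unfolding C_def by blast
  have serr: "norm ((\<integral>x. s n (k, x) *\<^sub>R x \<partial>F) - w k) \<le> 1 / real (Suc n)" if "k \<le> n" for n k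
    using s[of n] that unfolding C_def by blast
  show thesis
  proof
    show hm [measurable]: "h k \<in> borel_measurable F" for k
      unfolding h_def by measurable
    show "AE x in F. \<forall>k. h k x \<in> {0..1}"
      using lim
    proof eventually_elim
      case (elim x)
      show ?case
      proof
        fix k
        have "(\<lambda>n. s n (k, x)) \<longlonglongrightarrow> h k x" using elim by simp
        then show "h k x \<in> {0..1}"
          by (rule closed_sequentially[OF closed_atLeastAtMost, rotated]) (rule s01)
      qed
    qed
    show "AE x in F. \<forall>i j. \<rho> i \<le> \<rho> j \<longrightarrow> h j x \<le> h i x"
      using lim
    proof eventually_elim
      case (elim x)
      show ?case
      proof (intro allI impI)
        fix i j assume ij: "\<rho> i \<le> \<rho> j"
        have "s n (j, x) \<le> s n (i, x)" if "n \<ge> max i j" for n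
          using that ij by (intro smono) auto
        then show "h j x \<le> h i x"
          using elim by (intro LIMSEQ_le[of "\<lambda>n. s n (j, x)" _ "\<lambda>n. s n (i, x)"]) blast+
      qed
    qed
    show "(\<integral>x. h k x *\<^sub>R x \<partial>F) = (\<integral>y. of_bool (\<rho> k \<le> c y) *\<^sub>R y \<partial>G)" for k
    proof -
      have "(\<lambda>n. \<integral>x. s n (k, x) *\<^sub>R x \<partial>F) \<longlonglongrightarrow> (\<integral>x. h k x *\<^sub>R x \<partial>F)"
      proof (rule integral_dominated_convergence[where w = "\<lambda>_. 1"])
        show "AE x in F. (\<lambda>n. s n (k, x) *\<^sub>R x) \<longlonglongrightarrow> h k x *\<^sub>R x"
          using lim by eventually_elim (auto intro!: tendsto_scaleR)
        show "AE x in F. norm (s n (k, x) *\<^sub>R x) \<le> 1" for n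
        proof (rule AE_I2)
          fix x assume "x \<in> space F"
          then show "norm (s n (k, x) *\<^sub>R x) \<le> 1"
            using mult_mono[of "\<bar>s n (k, x)\<bar>" 1 "norm x" 1] s01[of n k x] belief_norm_le_1[of x]
            by (simp add: F.space_F)
        qed
        have [measurable]: "(\<lambda>x. x) \<in> borel_measurable F"
          unfolding measurable_cong_sets[OF F.sets_F refl] by measurable
        show "(\<lambda>x. h k x *\<^sub>R x) \<in> borel_measurable F" "(\<lambda>x. s n (k, x) *\<^sub>R x) \<in> borel_measurable F" for n
          by measurable
      qed simp
      moreover have "(\<lambda>n. \<integral>x. s n (k, x) *\<^sub>R x \<partial>F) \<longlonglongrightarrow> w k"
      proof (rule LIM_zero_cancel, rule tendsto_norm_zero_cancel)
        show "(\<lambda>n. norm ((\<integral>x. s n (k, x) *\<^sub>R x \<partial>F) - w k)) \<longlonglongrightarrow> 0"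
        proof (rule tendsto_sandwich[OF _ _ tendsto_const LIMSEQ_inverse_real_of_nat])
          show "\<forall>\<^sub>F n in sequentially. norm ((\<integral>x. s n (k, x) *\<^sub>R x \<partial>F) - w k) \<le> inverse (real (Suc n))"
            using eventually_ge_at_top[of k]
            by eventually_elim (unfold inverse_eq_divide, rule serr)
        qed simp
      qed
      ultimately show ?thesis
        unfolding w_def by (rule LIMSEQ_unique)
    qed
  qed
qed

section \<open>From survival functions to a coupling\<close>

lemma emeasure_weighted_law:
  fixes Z g :: "'a \<Rightarrow> real"
  assumes [measurable]: "Z \<in> borel_measurable M" "A \<in> sets borel"
    and g: "integrable M g" "\<And>x. x \<in> space M \<Longrightarrow> 0 \<le> g x"
  shows "emeasure (distr (density M (\<lambda>x. ennreal (g x))) borel Z) A =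
    ennreal (\<integral>x. of_bool (Z x \<in> A) * g x \<partial>M)"
proof -
  have [measurable]: "g \<in> borel_measurable M" using g by simp
  have "emeasure (distr (density M (\<lambda>x. ennreal (g x))) borel Z) A =
      (\<integral>\<^sup>+x. ennreal (g x) * indicator (Z -` A \<inter> space M) x \<partial>M)"
    by (simp add: emeasure_distr emeasure_density)
  also have "\<dots> = (\<integral>\<^sup>+x. ennreal (of_bool (Z x \<in> A) * g x) \<partial>M)"
    by (rule nn_integral_cong) (auto simp: indicator_def)
  also have "\<dots> = ennreal (\<integral>x. of_bool (Z x \<in> A) * g x \<partial>M)"
  proof (rule nn_integral_eq_integral)
    show "integrable M (\<lambda>x. of_bool (Z x \<in> A) * g x)"
      by (rule Bochner_Integration.integrable_bound[OF g(1)]) (auto simp: of_bool_def)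
  qed (auto intro!: AE_I2 g(2))
  finally show ?thesis .
qed

text \<open>Finite measures on the line agree once they agree on all open upper half-lines. Vector
  moments are not measures, so the coordinates of a belief serve one at a time as the nonnegative
  weight.\<close>

lemma weighted_law_eqI:
  fixes Z\<^sub>1 g\<^sub>1 :: "'a \<Rightarrow> real" and Z\<^sub>2 g\<^sub>2 :: "'b \<Rightarrow> real"
  assumes [measurable]: "Z\<^sub>1 \<in> borel_measurable M\<^sub>1" "Z\<^sub>2 \<in> borel_measurable M\<^sub>2"
    and g\<^sub>1: "integrable M\<^sub>1 g\<^sub>1" "\<And>x. x \<in> space M\<^sub>1 \<Longrightarrow> 0 \<le> g\<^sub>1 x"
    and g\<^sub>2: "integrable M\<^sub>2 g\<^sub>2" "\<And>x. x \<in> space M\<^sub>2 \<Longrightarrow> 0 \<le> g\<^sub>2 x"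
    and tails: "\<And>r. (\<integral>x. of_bool (r < Z\<^sub>1 x) * g\<^sub>1 x \<partial>M\<^sub>1) = (\<integral>x. of_bool (r < Z\<^sub>2 x) * g\<^sub>2 x \<partial>M\<^sub>2)"
    and B: "B \<in> sets borel"
  shows "(\<integral>x. of_bool (Z\<^sub>1 x \<in> B) * g\<^sub>1 x \<partial>M\<^sub>1) = (\<integral>x. of_bool (Z\<^sub>2 x \<in> B) * g\<^sub>2 x \<partial>M\<^sub>2)"
proof -
  let ?N\<^sub>1 = "distr (density M\<^sub>1 (\<lambda>x. ennreal (g\<^sub>1 x))) borel Z\<^sub>1"
  let ?N\<^sub>2 = "distr (density M\<^sub>2 (\<lambda>x. ennreal (g\<^sub>2 x))) borel Z\<^sub>2"
  have "?N\<^sub>1 = ?N\<^sub>2"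
    by (rule measure_eqI_lessThan) (simp_all add: emeasure_weighted_law g\<^sub>1 g\<^sub>2 tails)
  then have "ennreal (\<integral>x. of_bool (Z\<^sub>1 x \<in> B) * g\<^sub>1 x \<partial>M\<^sub>1) =
      ennreal (\<integral>x. of_bool (Z\<^sub>2 x \<in> B) * g\<^sub>2 x \<partial>M\<^sub>2)"
    using emeasure_weighted_law[OF assms(1) B g\<^sub>1] emeasure_weighted_law[OF assms(2) B g\<^sub>2] by simp
  moreover have "0 \<le> (\<integral>x. of_bool (Z\<^sub>1 x \<in> B) * g\<^sub>1 x \<partial>M\<^sub>1)"
    by (rule integral_nonneg_AE) (auto intro!: AE_I2 g\<^sub>1)
  moreover have "0 \<le> (\<integral>x. of_bool (Z\<^sub>2 x \<in> B) * g\<^sub>2 x \<partial>M\<^sub>2)"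
    by (rule integral_nonneg_AE) (auto intro!: AE_I2 g\<^sub>2)
  ultimately show ?thesis by simp
qed

text \<open>A single linear function is \<open>max_lin\<close> with \<open>n = 0\<close>. Testing
  the order with the difference of the two means as slope shows that its squared norm is at most
  0.\<close>

lemma max_lin_order_mean:
  fixes F G :: "(real ^ 'n::finite) measure"
  assumes "belief_law F" "belief_law G" and ord: "max_lin_order F G"
  shows "(\<integral>x. x \<partial>F) = (\<integral>x. x \<partial>G)"
proof -
  interpret F: belief_law F by fact
  interpret G: belief_law G by fact
  have i: "integrable F (\<lambda>x. x)" "integrable G (\<lambda>x. x)"
    using F.integrable_scaled_belief[of "\<lambda>_. 1"] G.integrable_scaled_belief[of "\<lambda>_. 1"] by simp_all
  have "a \<bullet> (\<integral>x. x \<partial>G) \<le> a \<bullet> (\<integral>x. x \<partial>F)" for a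
  proof -
    have "max_lin 0 (\<lambda>_. a) = (\<lambda>x. a \<bullet> x)" by (simp add: max_lin_def fun_eq_iff)
    then show ?thesis
      using ord[unfolded max_lin_order_def, rule_format, of 0 "\<lambda>_. a"] i by simp
  qed
  from this[of "(\<integral>x. x \<partial>G) - (\<integral>x. x \<partial>F)"]
  have "((\<integral>x. x \<partial>G) - (\<integral>x. x \<partial>F)) \<bullet> ((\<integral>x. x \<partial>G) - (\<integral>x. x \<partial>F)) \<le> 0"
    by (simp add: inner_diff_right)
  then show ?thesis
    using inner_ge_zero[of "(\<integral>x. x \<partial>G) - (\<integral>x. x \<partial>F)"]
    by (metis antisym eq_iff_diff_eq_0 inner_eq_zero_iff)
qed

lemma measure_uniform_unit:
  assumes "a \<in> {0..1}"
  shows "(\<integral>u. of_bool (u \<le> a) \<partial>uniform_measure lborel {0..1::real}) = a"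
proof -
  have "(\<integral>u. of_bool (u \<le> a) \<partial>uniform_measure lborel {0..1::real}) =
      (\<integral>u. indicator {..a} u \<partial>uniform_measure lborel {0..1::real})"
    by (rule Bochner_Integration.integral_cong) (auto simp: indicator_def)
  also have "\<dots> = measure (uniform_measure lborel {0..1::real}) {..a}"
    by simp
  also have "\<dots> = measure lborel ({0..1} \<inter> {..a}) / measure lborel {0..1::real}"
    by (rule measure_uniform_measure) auto
  also have "{0..1} \<inter> {..a} = {0..a}" using assms by auto
  finally show ?thesis using assms by simp
qed

text \<open>The coupling is sampled by drawing \<open>X\<close> from \<open>F\<close> and an independent uniform \<open>U\<close>, and by
  inverting the survival function \<open>h\<close> of the encoded second component at level \<open>U\<close>.\<close>

lemma quantile_coupling:
  fixes F G :: "(real ^ 'n::finite) measure" and c :: "real ^ 'n \<Rightarrow> real"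
  assumes "belief_law F" "belief_law G" and ord: "max_lin_order F G"
    and c [measurable]: "c \<in> borel_measurable borel" and c01: "\<And>y. c y \<in> {0..1}"
  obtains Z :: "(real ^ 'n) \<times> real \<Rightarrow> real"
  where "Z \<in> borel_measurable (F \<Otimes>\<^sub>M uniform_measure lborel {0..1})"
    and "\<And>r. (\<integral>\<omega>. of_bool (r < Z \<omega>) *\<^sub>R fst \<omega> \<partial>(F \<Otimes>\<^sub>M uniform_measure lborel {0..1})) =
             (\<integral>y. of_bool (r < c y) *\<^sub>R y \<partial>G)"
proof -
  interpret F: belief_law F by fact
  interpret G: belief_law G by fact
  define U where "U = uniform_measure lborel {0..1::real}"
  interpret U: prob_space U
    unfolding U_def by (rule prob_space_uniform_measure) auto
  have sets_U [measurable_cong]: "sets U = sets borel" by (simp add: U_def)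
  interpret FU: pair_prob_space F U ..
  let ?N = "F \<Otimes>\<^sub>M U"
  \<comment> \<open>The rationals are clamped to [0, 1], where \<open>c\<close> takes its values;
    the thresholds stay dense there.\<close>
  define \<rho> where "\<rho> k = max 0 (min 1 (real_of_rat (from_nat k)))" for k
  have \<rho>01: "0 \<le> \<rho> k" "\<rho> k \<le> 1" for k by (auto simp: \<rho>_def)
  have dense: "\<exists>k. r < \<rho> k \<and> \<rho> k < r + e" if r: "0 \<le> r" "r < 1" "e > 0" for r e
  proof -
    obtain q where q: "r < real_of_rat q" "real_of_rat q < min 1 (r + e)"
      using of_rat_dense[of r "min 1 (r + e)"] r by auto
    obtain k where "from_nat k = q" by (metis from_nat_to_nat)
    then show ?thesis using q r by (intro exI[of _ k]) (auto simp: \<rho>_def)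
  qed
  obtain h :: "nat \<Rightarrow> real ^ 'n \<Rightarrow> real"
    where h [measurable]: "\<And>k. h k \<in> borel_measurable F"
    and h01: "AE x in F. \<forall>k. h k x \<in> {0..1}"
    and hmono: "AE x in F. \<forall>i j. \<rho> i \<le> \<rho> j \<longrightarrow> h j x \<le> h i x"
    and hint: "\<And>k. (\<integral>x. h k x *\<^sub>R x \<partial>F) = (\<integral>y. of_bool (\<rho> k \<le> c y) *\<^sub>R y \<partial>G)"
    by (rule survival_kernel[OF assms(1,2) ord c, of \<rho>]) (rule that)
  have idF [measurable]: "(\<lambda>x. x) \<in> borel_measurable F"
    unfolding measurable_cong_sets[OF F.sets_F refl] by measurable
  have idG [measurable]: "(\<lambda>x. x) \<in> borel_measurable G"
    unfolding measurable_cong_sets[OF G.sets_F refl] by measurable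
  have fstN [measurable]: "fst \<in> borel_measurable ?N"
    using measurable_compose[OF measurable_fst idF, of U] by simp
  \<comment> \<open>\<open>Z\<close> is the supremum of the thresholds whose survival value is at
    least the uniform level \<open>snd \<omega>\<close>. The value 0 for all others keeps
    \<open>Z\<close> nonnegative and leaves the events \<open>r < Z \<omega>\<close> with
    \<open>0 \<le> r\<close> unaffected.\<close>
  define Z where "Z \<omega> = (SUP k. if snd \<omega> \<le> h k (fst \<omega>) then \<rho> k else 0)" for \<omega> :: "(real ^ 'n) \<times> real"
  have bdd: "bdd_above (range (\<lambda>k. if snd \<omega> \<le> h k (fst \<omega>) then \<rho> k else 0))" for \<omega> :: "(real ^ 'n) \<times> real"
    by (rule bdd_aboveI[of _ 1]) (auto simp: \<rho>01)
  have Zm [measurable]: "Z \<in> borel_measurable ?N"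
    unfolding Z_def
  proof (rule borel_measurable_cSUP)
    show "(\<lambda>\<omega>. if snd \<omega> \<le> h k (fst \<omega>) then \<rho> k else 0) \<in> borel_measurable ?N" for k
      by measurable
  qed (use bdd in auto)
  have Z_less: "r < Z \<omega> \<longleftrightarrow> (\<exists>k. snd \<omega> \<le> h k (fst \<omega>) \<and> r < \<rho> k)" if "0 \<le> r" for r \<omega>
    unfolding Z_def using that by (subst less_cSUP_iff[OF _ bdd]) (auto split: if_splits)
  have Z01: "Z \<omega> \<in> {0..1}" for \<omega>
  proof -
    have "0 \<le> Z \<omega>"
      unfolding Z_def by (rule cSUP_upper2[OF bdd, of 0]) (auto simp: \<rho>01)
    moreover have "Z \<omega> \<le> 1"
      unfolding Z_def by (rule cSUP_least) (auto simp: \<rho>01)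
    ultimately show ?thesis by simp
  qed
  have norm1: "norm (of_bool b *\<^sub>R fst \<omega>) \<le> 1" if "\<omega> \<in> space ?N" for b and \<omega> :: "(real ^ 'n) \<times> real"
    using that belief_norm_le_1[of "fst \<omega>"] by (auto simp: space_pair_measure F.space_F)
  have norm1G: "norm (of_bool b *\<^sub>R y) \<le> 1" if "y \<in> space G" for b and y :: "real ^ 'n"
    using that belief_norm_le_1[of y] by (auto simp: G.space_F)
  have level: "(\<integral>\<omega>. of_bool (snd \<omega> \<le> h k (fst \<omega>)) *\<^sub>R fst \<omega> \<partial>?N) =
      (\<integral>y. of_bool (\<rho> k \<le> c y) *\<^sub>R y \<partial>G)" for k
  proof -
    have "integrable ?N (\<lambda>\<omega>. of_bool (snd \<omega> \<le> h k (fst \<omega>)) *\<^sub>R fst \<omega>)"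
      by (rule FU.integrable_const_bound[OF AE_I2, OF norm1]) measurable
    then have "(\<integral>\<omega>. of_bool (snd \<omega> \<le> h k (fst \<omega>)) *\<^sub>R fst \<omega> \<partial>?N) =
        (\<integral>x. (\<integral>u. of_bool (u \<le> h k x) *\<^sub>R x \<partial>U) \<partial>F)"
      by (subst FU.integral_fst'[symmetric]) simp_all
    also have "\<dots> = (\<integral>x. h k x *\<^sub>R x \<partial>F)"
    proof (rule integral_cong_AE)
      show "AE x in F. (\<integral>u. of_bool (u \<le> h k x) *\<^sub>R x \<partial>U) = h k x *\<^sub>R x"
        using h01
      proof eventually_elim
        case (elim x)
        have "integrable U (\<lambda>u. of_bool (u \<le> h k x) :: real)"
          by (rule U.integrable_const_bound[where B = 1]) auto
        then show ?case
          using measure_uniform_unit[of "h k x"] elim by (simp add: U_def)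
      qed
    qed measurable
    finally show ?thesis by (simp add: hint)
  qed
  have tail: "(\<integral>\<omega>. of_bool (r < Z \<omega>) *\<^sub>R fst \<omega> \<partial>?N) = (\<integral>y. of_bool (r < c y) *\<^sub>R y \<partial>G)" for r
  proof -
    consider "r < 0" | "1 \<le> r" | "0 \<le> r" "r < 1" by linarith
    then show ?thesis
    proof cases
      case 1
      \<comment> \<open>Both events are certain here, so the claim reduces to the equality of the
        means.\<close>
      have "of_bool (r < Z \<omega>) *\<^sub>R fst \<omega> = fst \<omega>" "of_bool (r < c y) *\<^sub>R y = y" for \<omega> y
        using Z01[of \<omega>] c01[of y] 1 by auto
      moreover have "(\<integral>\<omega>. fst \<omega> \<partial>?N) = (\<integral>x. x \<partial>F)"
        using U.distr_pair_fst[of F] integral_distr[OF measurable_fst, of "\<lambda>x. x" F U] idF by simp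
      ultimately show ?thesis
        using max_lin_order_mean[OF assms(1-3)] by simp
    next
      case 2
      have "of_bool (r < Z \<omega>) *\<^sub>R fst \<omega> = 0" "of_bool (r < c y) *\<^sub>R y = 0" for \<omega> y
        using Z01[of \<omega>] c01[of y] 2 by auto
      then show ?thesis by (simp only: Bochner_Integration.integral_zero)
    next
      case 3
      \<comment> \<open>Thresholds strictly above \<open>r\<close> and tending to \<open>r\<close>
        exhaust the open tail from inside. Together with monotonicity of \<open>h\<close> this makes
        the indicators converge, so continuity of \<open>h\<close> in the threshold is not an
        issue.\<close>
      have "\<exists>k. r < \<rho> k \<and> \<rho> k < r + 1 / Suc m" for m
        by (rule dense[OF 3]) simp
      then obtain \<kappa> where \<kappa>: "\<And>m. r < \<rho> (\<kappa> m)" "\<And>m. \<rho> (\<kappa> m) < r + 1 / Suc m" by metis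
      have ev: "\<forall>\<^sub>F m in sequentially. \<rho> (\<kappa> m) < t" if rt: "r < t" for t
      proof -
        obtain m0 where m0: "1 / real (Suc m0) < t - r"
          using nat_approx_posE[of "t - r"] rt by auto
        have "\<rho> (\<kappa> m) < t" if "m \<ge> m0" for m
        proof -
          have "1 / real (Suc m) \<le> 1 / Suc m0" using that by (simp add: frac_le)
          then show ?thesis using m0 \<kappa>(2)[of m] by argo
        qed
        then show ?thesis by (auto simp: eventually_sequentially)
      qed
      have "(\<lambda>m. \<integral>\<omega>. of_bool (snd \<omega> \<le> h (\<kappa> m) (fst \<omega>)) *\<^sub>R fst \<omega> \<partial>?N)
          \<longlonglongrightarrow> (\<integral>\<omega>. of_bool (r < Z \<omega>) *\<^sub>R fst \<omega> \<partial>?N)"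
      proof (rule integral_dominated_convergence[where w = "\<lambda>_. 1"])
        have "AE x in distr ?N F fst. \<forall>i j. \<rho> i \<le> \<rho> j \<longrightarrow> h j x \<le> h i x"
          unfolding U.distr_pair_fst by (rule hmono)
        then have "AE \<omega> in ?N. \<forall>i j. \<rho> i \<le> \<rho> j \<longrightarrow> h j (fst \<omega>) \<le> h i (fst \<omega>)"
          by (rule AE_distrD[OF measurable_fst])
        then show "AE \<omega> in ?N. (\<lambda>m. of_bool (snd \<omega> \<le> h (\<kappa> m) (fst \<omega>)) *\<^sub>R fst \<omega>)
            \<longlonglongrightarrow> of_bool (r < Z \<omega>) *\<^sub>R fst \<omega>"
        proof eventually_elim
          case (elim \<omega>)
          have "\<forall>\<^sub>F m in sequentially. (snd \<omega> \<le> h (\<kappa> m) (fst \<omega>)) = (r < Z \<omega>)"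
          proof (cases "r < Z \<omega>")
            case True
            then obtain k where k: "snd \<omega> \<le> h k (fst \<omega>)" "r < \<rho> k"
              using Z_less 3(1) by blast
            from ev[OF k(2)] show ?thesis
            proof eventually_elim
              case (elim m)
              then have "h k (fst \<omega>) \<le> h (\<kappa> m) (fst \<omega>)"
                using \<open>\<forall>i j. \<rho> i \<le> \<rho> j \<longrightarrow> h j (fst \<omega>) \<le> h i (fst \<omega>)\<close> by simp
              then show ?case using k True by simp
            qed
          next
            case False
            then have "\<not> snd \<omega> \<le> h (\<kappa> m) (fst \<omega>)" for m
              using Z_less[OF 3(1)] \<kappa>(1) by blast
            then show ?thesis using False by simp
          qed
          then show ?case
            by (intro tendsto_eventually) (auto elim: eventually_mono)
        qed
        show "AE \<omega> in ?N. norm (of_bool (snd \<omega> \<le> h (\<kappa> m) (fst \<omega>)) *\<^sub>R fst \<omega>) \<le> 1" for m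
          by (intro AE_I2 norm1)
        show "(\<lambda>\<omega>. of_bool (r < Z \<omega>) *\<^sub>R fst \<omega>) \<in> borel_measurable ?N"
          "(\<lambda>\<omega>. of_bool (snd \<omega> \<le> h (\<kappa> m) (fst \<omega>)) *\<^sub>R fst \<omega>) \<in> borel_measurable ?N" for m
          by measurable
      qed simp
      moreover have "(\<lambda>m. \<integral>y. of_bool (\<rho> (\<kappa> m) \<le> c y) *\<^sub>R y \<partial>G) \<longlonglongrightarrow> (\<integral>y. of_bool (r < c y) *\<^sub>R y \<partial>G)"
      proof (rule integral_dominated_convergence[where w = "\<lambda>_. 1"])
        show "AE y in G. (\<lambda>m. of_bool (\<rho> (\<kappa> m) \<le> c y) *\<^sub>R y) \<longlonglongrightarrow> of_bool (r < c y) *\<^sub>R y"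
        proof (rule AE_I2)
          fix y
          have "\<forall>\<^sub>F m in sequentially. (\<rho> (\<kappa> m) \<le> c y) = (r < c y)"
          proof (cases "r < c y")
            case True
            from ev[OF this] show ?thesis by eventually_elim (use True in auto)
          next
            case False
            then have "\<not> \<rho> (\<kappa> m) \<le> c y" for m using \<kappa>(1)[of m] by linarith
            then show ?thesis using False by simp
          qed
          then show "(\<lambda>m. of_bool (\<rho> (\<kappa> m) \<le> c y) *\<^sub>R y) \<longlonglongrightarrow> of_bool (r < c y) *\<^sub>R y"
            by (intro tendsto_eventually) (auto elim: eventually_mono)
        qed
        show "AE y in G. norm (of_bool (\<rho> (\<kappa> m) \<le> c y) *\<^sub>R y) \<le> 1" for m
          by (intro AE_I2 norm1G)
        show "(\<lambda>y. of_bool (r < c y) *\<^sub>R y) \<in> borel_measurable G"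
          "(\<lambda>y. of_bool (\<rho> (\<kappa> m) \<le> c y) *\<^sub>R y) \<in> borel_measurable G" for m
          by measurable
      qed simp
      ultimately show ?thesis
        unfolding level by (rule LIMSEQ_unique)
    qed
  qed
  show thesis
    by (rule that[of Z]) (fact Zm[unfolded U_def], fact tail[unfolded U_def])
qed

lemma sum_beliefs: "x \<in> beliefs \<Longrightarrow> (\<Sum>\<theta>\<in>UNIV. x $ \<theta>) = 1"
  and belief_nonneg: "x \<in> beliefs \<Longrightarrow> 0 \<le> x $ \<theta>"
  by (simp_all add: beliefs_def)

lemma belief_le_1: "x \<in> beliefs \<Longrightarrow> x $ \<theta> \<le> 1"
  using component_le_norm_cart[of x \<theta>] belief_norm_le_1[of x] by linarith

text \<open>All claims about Y come from the identity \<open>moment\<close>. Summed over \<theta> it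
  gives the law of Y, because the coordinates of X and of y sum to 1. With that law, its right-hand
  side is the integral of a coordinate of Y over the event, which is the defining property of the
  conditional expectation.\<close>

theorem strassen_beliefs:
  fixes F G :: "(real ^ 'n::finite) measure"
  assumes "belief_law F" "belief_law G" "max_lin_order F G"
  shows "F \<succeq> G"
proof -
  interpret F: belief_law F by fact
  interpret G: belief_law G by fact
  obtain c :: "real ^ 'n \<Rightarrow> real" and \<psi>\<^sub>0 :: "real \<Rightarrow> real ^ 'n"
    where c [measurable]: "c \<in> borel_measurable borel"
      and \<psi>\<^sub>0 [measurable]: "\<psi>\<^sub>0 \<in> borel_measurable borel"
      and c01: "\<And>y. c y \<in> {0..1}"
      and inv0: "\<And>y. \<forall>i. 0 \<le> y $ i \<and> y $ i < 2 \<Longrightarrow> \<psi>\<^sub>0 (c y) = y"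
    by (rule borel_embedding_real) (rule that)
  define U where "U = uniform_measure lborel {0..1::real}"
  interpret U: prob_space U
    unfolding U_def by (rule prob_space_uniform_measure) auto
  interpret FU: pair_prob_space F U ..
  define N where "N = F \<Otimes>\<^sub>M U"
  have N: "prob_space N" unfolding N_def by (rule FU.prob_space_axioms)
  interpret N: prob_space N by (rule N)
  obtain Z where Z [measurable]: "Z \<in> borel_measurable N"
    and tails: "\<And>r. (\<integral>\<omega>. of_bool (r < Z \<omega>) *\<^sub>R fst \<omega> \<partial>N) = (\<integral>y. of_bool (r < c y) *\<^sub>R y \<partial>G)"
    by (rule quantile_coupling[OF assms c c01, folded U_def N_def]) (rule that)
  obtain y\<^sub>0 where y\<^sub>0: "y\<^sub>0 \<in> (beliefs :: (real ^ 'n) set)"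
    using F.not_empty F.space_F by auto
  \<comment> \<open>Real numbers that decode to no belief are sent to the fixed belief
    \<open>y\<^sub>0\<close>, so that Y takes values in \<open>beliefs\<close> everywhere and not
    just almost surely.\<close>
  define \<psi> where "\<psi> z = (if \<psi>\<^sub>0 z \<in> beliefs then \<psi>\<^sub>0 z else y\<^sub>0)" for z
  have \<psi>b: "\<psi> z \<in> beliefs" for z by (simp add: \<psi>_def y\<^sub>0)
  have \<psi> [measurable]: "\<psi> \<in> borel \<rightarrow>\<^sub>M belief_space"
    unfolding belief_space_def
  proof (rule measurable_restrict_space2)
    show "\<psi> \<in> borel_measurable borel" unfolding \<psi>_def by measurable
  qed (use \<psi>b in auto)
  have inv: "\<psi> (c y) = y" if "y \<in> beliefs" for y
  proof -
    have "0 \<le> y $ i \<and> y $ i < 2" for i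
      using belief_nonneg[OF that, of i] belief_le_1[OF that, of i] by simp
    then show ?thesis using inv0[of y] that by (simp add: \<psi>_def)
  qed
  have fstN [measurable]: "fst \<in> N \<rightarrow>\<^sub>M belief_space"
    unfolding N_def measurable_cong_sets[OF refl F.sets_F[symmetric]] by measurable
  have fst_belief: "fst \<omega> \<in> beliefs" if "\<omega> \<in> space N" for \<omega>
    using that by (auto simp: N_def space_pair_measure F.space_F)
  have fst_nth [measurable]: "(\<lambda>\<omega>. fst \<omega> $ \<theta>) \<in> borel_measurable N" for \<theta>
    by measurable
  have cG [measurable]: "c \<in> borel_measurable G"
    unfolding measurable_cong_sets[OF G.sets_F refl] by measurable
  have nthG [measurable]: "(\<lambda>y. y $ \<theta>) \<in> borel_measurable G" for \<theta>
    unfolding measurable_cong_sets[OF G.sets_F refl] by measurable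
  have intN: "integrable N (\<lambda>\<omega>. fst \<omega> $ \<theta>)" for \<theta>
    by (rule N.integrable_const_bound[where B = 1])
      (auto intro!: AE_I2 simp: belief_nonneg belief_le_1 fst_belief)
  have intG: "integrable G (\<lambda>y. y $ \<theta>)" for \<theta>
    by (rule G.integrable_const_bound[where B = 1])
      (auto intro!: AE_I2 simp: belief_nonneg belief_le_1 G.space_F)
  have vec: "(\<integral>\<omega>. of_bool (r < Z \<omega>) * fst \<omega> $ \<theta> \<partial>N) = (\<integral>y. of_bool (r < c y) * y $ \<theta> \<partial>G)" for r \<theta>
  proof -
    have iN: "integrable N (\<lambda>\<omega>. of_bool (r < Z \<omega>) *\<^sub>R fst \<omega>)"
      by (rule N.integrable_const_bound[where B = 1])
        (auto intro!: AE_I2 simp: belief_norm_le_1 fst_belief)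
    have iG: "integrable G (\<lambda>y. of_bool (r < c y) *\<^sub>R y)"
      by (rule G.integrable_scaled_belief) auto
    show ?thesis
      using integral_bounded_linear[OF bounded_linear_vec_nth iN, of \<theta>]
        integral_bounded_linear[OF bounded_linear_vec_nth iG, of \<theta>] tails[of r] by simp
  qed
  have moment: "(\<integral>\<omega>. of_bool (\<psi> (Z \<omega>) \<in> B) * fst \<omega> $ \<theta> \<partial>N) = (\<integral>y. of_bool (y \<in> B) * y $ \<theta> \<partial>G)"
    if [measurable]: "B \<in> sets belief_space" for B \<theta>
  proof -
    \<comment> \<open>The code \<open>Z\<close> under \<open>N\<close> and the code \<open>c\<close>
      under \<open>G\<close> have the same weighted tails, hence the same weighted laws. The set
      \<open>B\<close> is tested through its preimage under \<open>\<psi>\<close>, which undoes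
      \<open>c\<close> on beliefs.\<close>
    have "(\<integral>\<omega>. of_bool (Z \<omega> \<in> \<psi> -` B) * fst \<omega> $ \<theta> \<partial>N) = (\<integral>y. of_bool (c y \<in> \<psi> -` B) * y $ \<theta> \<partial>G)"
    proof (rule weighted_law_eqI[OF Z cG intN _ intG _ vec])
      show "\<psi> -` B \<in> sets borel"
        using measurable_sets[OF \<psi> that] by simp
    qed (auto simp: belief_nonneg fst_belief G.space_F)
    also have "\<dots> = (\<integral>y. of_bool (y \<in> B) * y $ \<theta> \<partial>G)"
      by (rule Bochner_Integration.integral_cong) (auto simp: inv G.space_F)
    finally show ?thesis by simp
  qed
  define Y where "Y \<omega> = \<psi> (Z \<omega>)" for \<omega>
  have Y [measurable]: "Y \<in> N \<rightarrow>\<^sub>M belief_space"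
    unfolding Y_def by measurable
  have law_Y: "distr N belief_space Y = G"
  proof (rule measure_eqI)
    fix B assume "B \<in> sets (distr N belief_space Y)"
    then have B [measurable]: "B \<in> sets belief_space" by simp
    have BG: "B \<in> sets G" using B G.sets_F by simp
    have iN: "integrable N (\<lambda>\<omega>. of_bool (Y \<omega> \<in> B) * fst \<omega> $ \<theta>)" for \<theta>
    proof (rule Bochner_Integration.integrable_bound[OF intN[of \<theta>]])
      have "(\<lambda>\<omega>. of_bool (Y \<omega> \<in> B)) \<in> borel_measurable N"
        by measurable
      then show "(\<lambda>\<omega>. of_bool (Y \<omega> \<in> B) * fst \<omega> $ \<theta>) \<in> borel_measurable N"
        by (rule borel_measurable_times[OF _ fst_nth])
    qed auto
    have iG: "integrable G (\<lambda>y. of_bool (y \<in> B) * y $ \<theta>)" for \<theta>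
    proof (rule Bochner_Integration.integrable_bound[OF intG[of \<theta>]])
      have "(\<lambda>y. of_bool (y \<in> B)) \<in> borel_measurable G"
        using BG by measurable
      then show "(\<lambda>y. of_bool (y \<in> B) * y $ \<theta>) \<in> borel_measurable G"
        by (rule borel_measurable_times[OF _ nthG])
    qed auto
    have "measure N (Y -` B \<inter> space N) = (\<integral>\<omega>. indicator (Y -` B \<inter> space N) \<omega> \<partial>N)"
      by (simp add: Int_absorb2)
    also have "\<dots> = (\<integral>\<omega>. (\<Sum>\<theta>\<in>UNIV. of_bool (Y \<omega> \<in> B) * fst \<omega> $ \<theta>) \<partial>N)"
      by (rule Bochner_Integration.integral_cong)
        (auto simp: sum_distrib_left[symmetric] sum_beliefs fst_belief indicator_def)
    also have "\<dots> = (\<Sum>\<theta>\<in>UNIV. \<integral>\<omega>. of_bool (Y \<omega> \<in> B) * fst \<omega> $ \<theta> \<partial>N)"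
      by (rule Bochner_Integration.integral_sum) (rule iN)
    also have "\<dots> = (\<Sum>\<theta>\<in>UNIV. \<integral>y. of_bool (y \<in> B) * y $ \<theta> \<partial>G)"
      unfolding Y_def by (simp add: moment)
    also have "\<dots> = (\<integral>y. (\<Sum>\<theta>\<in>UNIV. of_bool (y \<in> B) * y $ \<theta>) \<partial>G)"
      by (rule Bochner_Integration.integral_sum[symmetric]) (rule iG)
    also have "\<dots> = (\<integral>y. indicator B y \<partial>G)"
      by (rule Bochner_Integration.integral_cong)
        (auto simp: sum_distrib_left[symmetric] sum_beliefs G.space_F indicator_def)
    also have "\<dots> = measure G B"
      using BG by (simp add: Int_absorb2 sets.sets_into_space)
    finally show "emeasure (distr N belief_space Y) B = emeasure G B"
      by (simp add: emeasure_distr N.emeasure_eq_measure G.emeasure_eq_measure)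
  qed (simp add: G.sets_F)
  \<comment> \<open>The coupling is moved to pairs of vectors, the sample space fixed in the
    definition of a mean-preserving spread; X and Y become the projections.\<close>
  define M where "M = distr N (belief_space \<Otimes>\<^sub>M belief_space) (\<lambda>\<omega>. (fst \<omega>, Y \<omega>))"
  have spaceM: "space M = beliefs \<times> beliefs" by (simp add: M_def space_pair_measure)
  have pairN [measurable]: "(\<lambda>\<omega>. (fst \<omega>, Y \<omega>)) \<in> N \<rightarrow>\<^sub>M belief_space \<Otimes>\<^sub>M belief_space"
    by measurable
  have setsM [measurable_cong]: "sets M = sets (belief_space \<Otimes>\<^sub>M belief_space)"
    by (simp add: M_def)
  interpret M: prob_space M
    unfolding M_def by (rule N.prob_space_distr) measurable
  let ?V = "vimage_algebra (space M) snd (belief_space :: (real ^ 'n) measure)"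
  have sub: "subalgebra M ?V"
    unfolding subalgebra_def
  proof
    show "sets ?V \<subseteq> sets M"
      by (rule sets_image_in_sets) (auto simp: measurable_cong_sets[OF setsM refl])
  qed simp
  interpret V: finite_measure_subalgebra M ?V
    by (intro finite_measure_subalgebra.intro finite_measure_subalgebra_axioms.intro
        M.finite_measure_axioms sub)
  show ?thesis
    unfolding mean_preserving_spread_def
  proof (rule exI[of _ M], rule exI[of _ fst], rule exI[of _ snd], intro conjI allI)
    show "prob_space M" by (rule M.prob_space_axioms)
    show "fst \<in> M \<rightarrow>\<^sub>M belief_space" "snd \<in> M \<rightarrow>\<^sub>M belief_space"
      unfolding measurable_cong_sets[OF setsM refl] by measurable
    have "distr M belief_space fst = distr N belief_space fst"
      unfolding M_def by (subst distr_distr) (auto simp: comp_def)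
    also have "\<dots> = distr (F \<Otimes>\<^sub>M U) F fst"
      unfolding N_def by (rule distr_cong) (simp_all add: F.sets_F)
    also have "\<dots> = F" by (rule U.distr_pair_fst)
    finally show "distr M belief_space fst = F" .
    show "distr M belief_space snd = G"
      unfolding M_def by (subst distr_distr) (auto simp: comp_def law_Y)
    have m [measurable]: "(\<lambda>\<omega>. fst \<omega> $ \<theta>) \<in> borel_measurable (belief_space \<Otimes>\<^sub>M belief_space)"
      "(\<lambda>\<omega>. snd \<omega> $ \<theta>) \<in> borel_measurable (belief_space \<Otimes>\<^sub>M belief_space)" for \<theta> :: 'n
      by measurable
    show "AE \<omega> in M. real_cond_exp M ?V (\<lambda>\<omega>. fst \<omega> $ \<theta>) \<omega> = snd \<omega> $ \<theta>" for \<theta>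
    proof (rule V.real_cond_exp_charact)
      show "integrable M (\<lambda>\<omega>. fst \<omega> $ \<theta>)" "integrable M (\<lambda>\<omega>. snd \<omega> $ \<theta>)"
        by (rule M.integrable_const_bound[where B = 1],
            (auto intro!: AE_I2 simp: belief_nonneg belief_le_1 spaceM)[1], measurable)+
      show "(\<lambda>\<omega>. snd \<omega> $ \<theta>) \<in> borel_measurable ?V"
        by (rule measurable_compose[OF measurable_vimage_algebra1, of snd _ belief_space])
          (auto simp: spaceM)
      fix A assume "A \<in> sets ?V"
      then obtain B where B [measurable]: "B \<in> sets belief_space" and A: "A = snd -` B \<inter> space M"
        by (subst (asm) sets_vimage_algebra2) (auto simp: spaceM)
      have BG: "B \<in> sets G" using B G.sets_F by simp
      have sndB: "(\<lambda>\<omega>. of_bool (snd \<omega> \<in> B)) \<in> borel_measurable (belief_space \<Otimes>\<^sub>M belief_space)"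
        by measurable
      have B_nth: "(\<lambda>y. of_bool (y \<in> B) * y $ \<theta>) \<in> borel_measurable belief_space"
        by measurable
      have "(\<integral>\<omega>\<in>A. fst \<omega> $ \<theta> \<partial>M) = (\<integral>\<omega>. of_bool (snd \<omega> \<in> B) * fst \<omega> $ \<theta> \<partial>M)"
        unfolding set_lebesgue_integral_def A
        by (rule Bochner_Integration.integral_cong) (auto simp: indicator_def)
      also have "\<dots> = (\<integral>\<omega>. of_bool (Y \<omega> \<in> B) * fst \<omega> $ \<theta> \<partial>N)"
        unfolding M_def by (subst integral_distr[OF pairN borel_measurable_times[OF sndB m(1)]]) simp
      also have "\<dots> = (\<integral>y. of_bool (y \<in> B) * y $ \<theta> \<partial>G)"
        unfolding Y_def by (rule moment[OF B])
      also have "\<dots> = (\<integral>\<omega>. of_bool (Y \<omega> \<in> B) * Y \<omega> $ \<theta> \<partial>N)"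
        by (subst law_Y[symmetric], subst integral_distr[OF Y B_nth]) simp
      also have "\<dots> = (\<integral>\<omega>. of_bool (snd \<omega> \<in> B) * snd \<omega> $ \<theta> \<partial>M)"
        unfolding M_def by (subst integral_distr[OF pairN borel_measurable_times[OF sndB m(2)]]) simp
      also have "\<dots> = (\<integral>\<omega>\<in>A. snd \<omega> $ \<theta> \<partial>M)"
        unfolding set_lebesgue_integral_def A
        by (rule Bochner_Integration.integral_cong) (auto simp: indicator_def)
      finally show "(\<integral>\<omega>\<in>A. fst \<omega> $ \<theta> \<partial>M) = (\<integral>\<omega>\<in>A. snd \<omega> $ \<theta> \<partial>M)" .
    qed
  qed
qed

text \<open>This is Jensen's inequality with an explicit subgradient. The slope \<open>s\<close>
  active at Y is a function of Y, so conditioning gives the same expectation for its products with X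
  and with Y. At Y the product is the maximum, at X it is at most the maximum.\<close>

lemma mps_imp_max_lin_order:
  fixes F G :: "(real ^ 'n::finite) measure"
  assumes "F \<succeq> G"
  shows "max_lin_order F G"
  unfolding max_lin_order_def
proof (intro allI)
  fix n and b :: "nat \<Rightarrow> real ^ 'n"
  obtain M :: "((real ^ 'n) \<times> (real ^ 'n)) measure" and X Y
    where M: "prob_space M"
      and X [measurable]: "X \<in> M \<rightarrow>\<^sub>M belief_space" and law_X: "distr M belief_space X = F"
      and Y [measurable]: "Y \<in> M \<rightarrow>\<^sub>M belief_space" and law_Y: "distr M belief_space Y = G"
      and mart: "\<And>\<theta>. AE \<omega> in M.
        real_cond_exp M (vimage_algebra (space M) Y belief_space) (\<lambda>\<omega>. X \<omega> $ \<theta>) \<omega> = Y \<omega> $ \<theta>"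
    using assms unfolding mean_preserving_spread_def by blast
  interpret prob_space M by (rule M)
  let ?V = "vimage_algebra (space M) Y (belief_space :: (real ^ 'n) measure)"
  have Yb: "Y \<omega> \<in> beliefs" and Xb: "X \<omega> \<in> beliefs" if "\<omega> \<in> space M" for \<omega>
    using measurable_space[OF Y that] measurable_space[OF X that] by simp_all
  have sub: "subalgebra M ?V"
    unfolding subalgebra_def
  proof
    show "sets ?V \<subseteq> sets M"
      by (rule sets_image_in_sets) (use Y in auto)
  qed simp
  interpret V: finite_measure_subalgebra M ?V
    by (intro finite_measure_subalgebra.intro finite_measure_subalgebra_axioms.intro
        finite_measure_axioms sub)
  define s where "s \<omega> = b (arg_max_lin n b (Y \<omega>))" for \<omega>
  define K where "K = (\<Sum>j\<le>n. norm (b j))"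
  have s_V: "(\<lambda>\<omega>. s \<omega> $ \<theta>) \<in> borel_measurable ?V" for \<theta>
  proof -
    have "(\<lambda>y. b (arg_max_lin n b y) $ \<theta>) \<in> borel_measurable belief_space"
      by (rule measurable_compose[OF measurable_compose[OF belief_space_id arg_max_lin_measurable]]) simp
    moreover have "Y \<in> ?V \<rightarrow>\<^sub>M belief_space"
      by (rule measurable_vimage_algebra1) (use Yb in auto)
    ultimately show ?thesis
      unfolding s_def by (rule measurable_compose[rotated])
  qed
  have s_M: "(\<lambda>\<omega>. s \<omega> $ \<theta>) \<in> borel_measurable M" for \<theta>
    by (rule measurable_from_subalg[OF sub s_V])
  have X_nth: "(\<lambda>\<omega>. X \<omega> $ \<theta>) \<in> borel_measurable M" and Y_nth: "(\<lambda>\<omega>. Y \<omega> $ \<theta>) \<in> borel_measurable M" for \<theta>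
    by measurable
  have s_le: "\<bar>s \<omega> $ \<theta>\<bar> \<le> K" for \<omega> \<theta>
  proof -
    have "norm (s \<omega>) \<le> K"
      unfolding s_def K_def by (rule member_le_sum) (auto intro: arg_max_lin(1))
    then show ?thesis using component_le_norm_cart[of "s \<omega>" \<theta>] by linarith
  qed
  have int: "integrable M (\<lambda>\<omega>. s \<omega> $ \<theta> * Z \<omega> $ \<theta>)"
    if Z: "(\<lambda>\<omega>. Z \<omega> $ \<theta>) \<in> borel_measurable M" "\<And>\<omega>. \<omega> \<in> space M \<Longrightarrow> Z \<omega> \<in> beliefs" for Z \<theta>
  proof (rule integrable_const_bound[where B = K])
    show "AE \<omega> in M. norm (s \<omega> $ \<theta> * Z \<omega> $ \<theta>) \<le> K"
    proof (rule AE_I2)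
      fix \<omega> assume "\<omega> \<in> space M"
      then have "\<bar>Z \<omega> $ \<theta>\<bar> \<le> 1" using Z(2) by (simp add: belief_nonneg belief_le_1)
      then show "norm (s \<omega> $ \<theta> * Z \<omega> $ \<theta>) \<le> K"
        using mult_mono[OF s_le[of \<omega> \<theta>], of "\<bar>Z \<omega> $ \<theta>\<bar>" 1] s_le[of \<omega> \<theta>] by (simp add: abs_mult)
    qed
    show "(\<lambda>\<omega>. s \<omega> $ \<theta> * Z \<omega> $ \<theta>) \<in> borel_measurable M"
      by (rule borel_measurable_times[OF s_M Z(1)])
  qed
  have "(\<integral>\<omega>. s \<omega> $ \<theta> * Y \<omega> $ \<theta> \<partial>M) = (\<integral>\<omega>. s \<omega> $ \<theta> * X \<omega> $ \<theta> \<partial>M)" for \<theta>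
  proof -
    have "(\<integral>\<omega>. s \<omega> $ \<theta> * Y \<omega> $ \<theta> \<partial>M) =
        (\<integral>\<omega>. s \<omega> $ \<theta> * real_cond_exp M ?V (\<lambda>\<omega>. X \<omega> $ \<theta>) \<omega> \<partial>M)"
    proof (rule integral_cong_AE)
      show "AE \<omega> in M. s \<omega> $ \<theta> * Y \<omega> $ \<theta> = s \<omega> $ \<theta> * real_cond_exp M ?V (\<lambda>\<omega>. X \<omega> $ \<theta>) \<omega>"
        using mart[of \<theta>] by eventually_elim simp
    qed (intro borel_measurable_times s_M Y_nth borel_measurable_cond_exp2)+
    also have "\<dots> = (\<integral>\<omega>. s \<omega> $ \<theta> * X \<omega> $ \<theta> \<partial>M)"
      by (rule V.real_cond_exp_intg(2)[OF int[OF X_nth Xb] s_V X_nth])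
    finally show ?thesis .
  qed
  then have eq: "(\<integral>\<omega>. s \<omega> \<bullet> Y \<omega> \<partial>M) = (\<integral>\<omega>. s \<omega> \<bullet> X \<omega> \<partial>M)"
    using int[OF X_nth Xb] int[OF Y_nth Yb] by (simp add: inner_vec_def)
  have max_lin_belief: "max_lin n b \<in> borel_measurable belief_space" by measurable
  have "(\<integral>x. max_lin n b x \<partial>G) = (\<integral>\<omega>. max_lin n b (Y \<omega>) \<partial>M)"
    unfolding law_Y[symmetric] by (rule integral_distr[OF Y max_lin_belief])
  also have "\<dots> = (\<integral>\<omega>. s \<omega> \<bullet> Y \<omega> \<partial>M)"
    unfolding s_def by (simp add: arg_max_lin(2))
  also have "\<dots> = (\<integral>\<omega>. s \<omega> \<bullet> X \<omega> \<partial>M)"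
    by (rule eq)
  also have "\<dots> \<le> (\<integral>\<omega>. max_lin n b (X \<omega>) \<partial>M)"
  proof (rule integral_mono)
    show "integrable M (\<lambda>\<omega>. s \<omega> \<bullet> X \<omega>)"
      using int[OF X_nth Xb] by (simp add: inner_vec_def)
    show "integrable M (\<lambda>\<omega>. max_lin n b (X \<omega>))"
      by (rule integrable_const_bound[where B = K])
        (use Xb in \<open>auto intro!: AE_I2 abs_max_lin_le member_le_sum simp: K_def\<close>)
    show "s \<omega> \<bullet> X \<omega> \<le> max_lin n b (X \<omega>)" for \<omega>
      unfolding s_def by (rule max_lin_ge) (rule arg_max_lin(1))
  qed
  also have "\<dots> = (\<integral>x. max_lin n b x \<partial>F)"
    unfolding law_X[symmetric] by (rule integral_distr[OF X max_lin_belief, symmetric])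
  finally show "(\<integral>x. max_lin n b x \<partial>G) \<le> (\<integral>x. max_lin n b x \<partial>F)" .
qed

theorem mps_iff_max_lin_order:
  assumes "belief_law F" "belief_law G"
  shows "F \<succeq> G \<longleftrightarrow> max_lin_order F G"
  using assms mps_imp_max_lin_order strassen_beliefs by blast

subsection \<open>Indirect utilities as support functions\<close>

definition support_fun :: "(real ^ 'n::finite) set \<Rightarrow> real ^ 'n \<Rightarrow> real" where
  "support_fun W x = (SUP w\<in>W. w \<bullet> x)"

lemma bdd_above_inner_image:
  assumes "bounded W"
  shows "bdd_above ((\<lambda>w. w \<bullet> x) ` W)"
proof -
  obtain K where K: "\<And>w. w \<in> W \<Longrightarrow> norm w \<le> K"
    using assms by (auto simp: bounded_iff)
  show ?thesis
  proof (rule bdd_aboveI2)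
    fix w assume "w \<in> W"
    then show "w \<bullet> x \<le> K * norm x"
      using norm_cauchy_schwarz[of w x] mult_right_mono[OF K, of w "norm x"] by simp
  qed
qed

text \<open>The maxima run over an enumeration of a countable dense subset. A strict inequality
  \<open>a < w \<bullet> x\<close> is an open condition on \<open>w\<close>, so it is met by some
  enumerated point. Measurability, bounds and the order all pass from finite maxima to support
  functions along this limit.\<close>

lemma support_fun_limit:
  assumes "bounded W" "W \<noteq> {}"
  obtains d where "range d \<subseteq> W" "\<And>x. (\<lambda>n. max_lin n d x) \<longlonglongrightarrow> support_fun W x"
proof -
  obtain D where D: "countable D" "D \<subseteq> W" "W \<subseteq> closure D"
    by (rule separable)
  with assms(2) have "D \<noteq> {}" by auto
  define d where "d = from_nat_into D"
  have range_d: "range d = D" unfolding d_def by (rule range_from_nat_into[OF \<open>D \<noteq> {}\<close> D(1)])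
  show thesis
  proof
    show "range d \<subseteq> W" using range_d D(2) by simp
    fix x
    have upper: "w \<bullet> x \<le> support_fun W x" if "w \<in> W" for w
      unfolding support_fun_def by (rule cSUP_upper[OF that bdd_above_inner_image[OF assms(1)]])
    show "(\<lambda>n. max_lin n d x) \<longlonglongrightarrow> support_fun W x"
    proof (rule order_tendstoI)
      fix a assume "a < support_fun W x"
      then obtain w where w: "w \<in> W" "a < w \<bullet> x"
        unfolding support_fun_def using less_cSUP_iff[OF assms(2) bdd_above_inner_image[OF assms(1)]] by blast
      have "open {w. a < w \<bullet> x}"
        by (intro open_Collect_less continuous_intros)
      then have "{w. a < w \<bullet> x} \<inter> D \<noteq> {}"
        using w D(3) open_Int_closure_eq_empty[of "{w. a < w \<bullet> x}" D] by blast
      then obtain k where k: "a < d k \<bullet> x" using range_d by blast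
      have "a < max_lin n d x" if "n \<ge> k" for n
        using k max_lin_ge[OF that, of d x] by linarith
      then show "\<forall>\<^sub>F n in sequentially. a < max_lin n d x"
        by (auto simp: eventually_sequentially)
    next
      fix a assume a: "support_fun W x < a"
      have "max_lin n d x < a" for n
        using upper[of "d (arg_max_lin n d x)"] range_d D(2) a arg_max_lin(2)[of d n x] by force
      then show "\<forall>\<^sub>F n in sequentially. max_lin n d x < a" by simp
    qed
  qed
qed

lemma support_fun_measurable:
  assumes "bounded W" "W \<noteq> {}"
  shows "support_fun W \<in> borel_measurable borel"
proof -
  obtain d where "\<And>x. (\<lambda>n. max_lin n d x) \<longlonglongrightarrow> support_fun W x"
    by (rule support_fun_limit[OF assms]) (rule that)
  then show ?thesis
    by (rule borel_measurable_LIMSEQ_metric[rotated]) measurable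
qed

lemma abs_support_fun_le:
  assumes "W \<noteq> {}" "\<And>w. w \<in> W \<Longrightarrow> norm w \<le> K" "x \<in> beliefs"
  shows "\<bar>support_fun W x\<bar> \<le> K"
proof -
  have "bounded W" using assms(2) by (auto simp: bounded_iff)
  then obtain d where d: "range d \<subseteq> W" "\<And>x. (\<lambda>n. max_lin n d x) \<longlonglongrightarrow> support_fun W x"
    by (rule support_fun_limit[OF _ assms(1)]) (rule that)
  have "\<bar>max_lin n d x\<bar> \<le> K" for n
    by (rule abs_max_lin_le[OF assms(3)]) (use d(1) assms(2) in auto)
  then show ?thesis
    by (intro LIMSEQ_le_const2[OF tendsto_rabs[OF d(2)]]) auto
qed

text \<open>A norm bound for \<open>W\<close> dominates every finite maximum on beliefs, so the
  inequality passes to the limit by dominated convergence.\<close>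

lemma max_lin_order_support_fun:
  fixes F G :: "(real ^ 'n::finite) measure"
  assumes "belief_law F" "belief_law G" and ord: "max_lin_order F G"
    and W: "bounded W" "W \<noteq> {}"
  shows "(\<integral>x. support_fun W x \<partial>G) \<le> (\<integral>x. support_fun W x \<partial>F)"
proof -
  obtain d where d: "range d \<subseteq> W" "\<And>x. (\<lambda>n. max_lin n d x) \<longlonglongrightarrow> support_fun W x"
    by (rule support_fun_limit[OF W]) (rule that)
  obtain K where K: "\<And>w. w \<in> W \<Longrightarrow> norm w \<le> K"
    using W(1) by (auto simp: bounded_iff)
  have lim: "(\<lambda>n. \<integral>x. max_lin n d x \<partial>H) \<longlonglongrightarrow> (\<integral>x. support_fun W x \<partial>H)"
    if "belief_law H" for H :: "(real ^ 'n) measure"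
  proof -
    interpret H: belief_law H by fact
    show ?thesis
    proof (rule integral_dominated_convergence[where w = "\<lambda>_. K"])
      show "AE x in H. norm (max_lin n d x) \<le> K" for n
        using d(1) K by (auto intro!: AE_I2 abs_max_lin_le simp: H.space_F)
      show "support_fun W \<in> borel_measurable H" "max_lin n d \<in> borel_measurable H" for n
        using measurable_compose[OF belief_space_id support_fun_measurable[OF W]]
          measurable_compose[OF belief_space_id max_lin_measurable]
        unfolding measurable_cong_sets[OF H.sets_F refl] by simp_all
    qed (simp_all add: d(2))
  qed
  show ?thesis
    by (rule LIMSEQ_le[OF lim[OF assms(2)] lim[OF assms(1)]])
      (use ord in \<open>auto simp: max_lin_order_def\<close>)
qed

subsection \<open>Posterior laws and discounting\<close>

lemma
  fixes \<mu> :: "real ^ 'n::finite"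
  assumes \<mu>: "\<mu> \<in> beliefs" and dis: "dynamic_information_structure T S \<pi>"
  shows prob_space_joint_law: "prob_space (joint_law T \<mu> S \<pi>)"
    and sets_joint_law: "sets (joint_law T \<mu> S \<pi>) = sets (count_space UNIV \<Otimes>\<^sub>M signal_space T S)"
proof -
  let ?\<Omega> = "count_space UNIV \<Otimes>\<^sub>M signal_space T S :: ('n \<times> (nat \<Rightarrow> 'a)) measure"
  let ?P = "point_measure UNIV (\<lambda>\<theta>. ennreal (\<mu> $ \<theta>))"
  have P: "?P \<in> space (prob_algebra (count_space UNIV))"
    unfolding space_prob_algebra
  proof (intro CollectI conjI prob_space_point_measure)
    show "(\<Sum>\<theta>\<in>UNIV. ennreal (\<mu> $ \<theta>)) = 1"
      using \<mu> by (simp add: beliefs_def)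
  qed (auto simp: sets_point_measure)
  have K: "(\<lambda>\<theta>. distr (\<pi> \<theta>) ?\<Omega> (Pair \<theta>)) \<in> count_space UNIV \<rightarrow>\<^sub>M prob_algebra ?\<Omega>"
  proof (simp, rule Pi_I)
    fix \<theta> :: 'n
    have "\<pi> \<theta> \<in> space (prob_algebra (signal_space T S))"
      using dis by (simp add: dynamic_information_structure_def)
    then have "prob_space (\<pi> \<theta>)" and sets_\<pi>: "sets (\<pi> \<theta>) = sets (signal_space T S)"
      by (simp_all add: space_prob_algebra)
    moreover have "Pair \<theta> \<in> \<pi> \<theta> \<rightarrow>\<^sub>M ?\<Omega>"
      unfolding measurable_cong_sets[OF sets_\<pi> refl] by (rule measurable_Pair1') simp
    ultimately show "distr (\<pi> \<theta>) ?\<Omega> (Pair \<theta>) \<in> space (prob_algebra ?\<Omega>)"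
      by (simp add: space_prob_algebra prob_space.prob_space_distr)
  qed
  show "prob_space (joint_law T \<mu> S \<pi>)"
    unfolding joint_law_def by (rule prob_space_bind'[OF P K])
  show "sets (joint_law T \<mu> S \<pi>) = sets ?\<Omega>"
    unfolding joint_law_def by (rule sets_bind'[OF P K])
qed

lemma subalgebra_history:
  fixes \<mu> :: "real ^ 'n::finite"
  assumes "\<mu> \<in> beliefs" "dynamic_information_structure T S \<pi>" and t: "t \<in> periods T"
  shows "subalgebra (joint_law T \<mu> S \<pi>) (history_algebra T S t)"
proof -
  let ?J = "joint_law T \<mu> S \<pi>"
  have space: "space ?J = UNIV \<times> space (signal_space T S)"
    using sets_eq_imp_space_eq[OF sets_joint_law[OF assms(1,2)]] by (simp add: space_pair_measure)
  have sub: "{1..t} \<subseteq> periods T"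
    using t by (auto simp: periods_def intro: order_trans[of _ "enat t"])
  have "(\<lambda>s. restrict s {1..t}) \<in> signal_space T S \<rightarrow>\<^sub>M (\<Pi>\<^sub>M r\<in>{1..t}. borel_of (S r))"
    unfolding signal_space_def by (rule measurable_restrict_subset[OF sub])
  from measurable_compose[OF measurable_snd this]
  have "(\<lambda>\<omega>. restrict (snd \<omega>) {1..t}) \<in> ?J \<rightarrow>\<^sub>M (\<Pi>\<^sub>M r\<in>{1..t}. borel_of (S r))"
    unfolding measurable_cong_sets[OF sets_joint_law[OF assms(1,2)] refl] .
  then have "(\<lambda>(\<theta>, s). restrict s {1..t}) \<in> ?J \<rightarrow>\<^sub>M (\<Pi>\<^sub>M r\<in>{1..t}. borel_of (S r))"
    by (simp add: case_prod_unfold)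
  then have "sets (history_algebra T S t) \<subseteq> sets ?J"
    unfolding history_algebra_def by (rule sets_image_in_sets[OF space])
  then show ?thesis
    by (simp add: subalgebra_def history_algebra_def space)
qed

text \<open>The indicators of the states are nonnegative and sum to 1, and conditional expectation
  preserves both facts almost surely. There are finitely many states, so the exceptional sets
  together are null and restriction to \<open>beliefs\<close> keeps mass 1.\<close>

lemma belief_law_posterior_law:
  fixes \<mu> :: "real ^ 'n::finite"
  assumes "\<mu> \<in> beliefs" "dynamic_information_structure T S \<pi>" "t \<in> periods T"
  shows "belief_law (posterior_law T \<mu> S \<pi> t)"
proof -
  let ?J = "joint_law T \<mu> S \<pi>" and ?H = "history_algebra T S t :: ('n \<times> (nat \<Rightarrow> 'a)) measure"
  let ?D = "distr ?J borel (posterior T \<mu> S \<pi> t)"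
  interpret J: prob_space ?J by (rule prob_space_joint_law[OF assms(1,2)])
  interpret H: finite_measure_subalgebra ?J ?H
    by (intro finite_measure_subalgebra.intro finite_measure_subalgebra_axioms.intro
        J.finite_measure_axioms subalgebra_history[OF assms])
  let ?I = "\<lambda>\<theta>. indicator ({\<theta>} \<times> UNIV) :: 'n \<times> (nat \<Rightarrow> 'a) \<Rightarrow> real"
  have I_meas: "?I \<theta> \<in> borel_measurable ?J" for \<theta>
  proof -
    have "?I \<theta> = (\<lambda>\<omega>. indicator {\<theta>} (fst \<omega>))" by (auto simp: fun_eq_iff indicator_def)
    moreover have "(\<lambda>\<omega>. indicator {\<theta>} (fst \<omega>) :: real) \<in> borel_measurable ?J"
      unfolding measurable_cong_sets[OF sets_joint_law[OF assms(1,2)] refl] by measurable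
    ultimately show ?thesis by simp
  qed
  have I_int: "integrable ?J (?I \<theta>)" for \<theta>
    by (rule J.integrable_const_bound[where B = 1]) (auto simp: I_meas indicator_def)
  have I_sum: "(\<Sum>\<theta>\<in>UNIV. ?I \<theta> \<omega>) = 1" for \<omega>
    by (cases \<omega>) (simp add: indicator_def)
  have post_meas: "posterior T \<mu> S \<pi> t \<in> borel_measurable ?J"
    unfolding posterior_def
    by (subst borel_measurable_euclidean_space) (auto simp: Basis_vec_def inner_axis)
  have "AE \<omega> in ?J. \<forall>\<theta>. 0 \<le> real_cond_exp ?J ?H (?I \<theta>) \<omega>"
    unfolding AE_all_countable
    by (auto intro!: H.real_cond_exp_pos simp: I_meas)
  moreover have "AE \<omega> in ?J. (\<Sum>\<theta>\<in>UNIV. real_cond_exp ?J ?H (?I \<theta>) \<omega>) = 1"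
  proof -
    have "AE \<omega> in ?J. real_cond_exp ?J ?H (\<lambda>\<omega>. \<Sum>\<theta>\<in>UNIV. ?I \<theta> \<omega>) \<omega> =
        (\<Sum>\<theta>\<in>UNIV. real_cond_exp ?J ?H (?I \<theta>) \<omega>)"
      by (rule H.real_cond_exp_sum) (rule I_int)
    moreover have "AE \<omega> in ?J. real_cond_exp ?J ?H (\<lambda>\<omega>. 1) \<omega> = 1"
      by (rule H.real_cond_exp_F_meas) auto
    ultimately show ?thesis unfolding I_sum by eventually_elim simp
  qed
  ultimately have post_beliefs: "AE \<omega> in ?J. posterior T \<mu> S \<pi> t \<omega> \<in> beliefs"
    by eventually_elim (simp add: beliefs_def posterior_def)
  have "prob_space (posterior_law T \<mu> S \<pi> t)"
    unfolding posterior_law_def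
  proof (rule prob_space_restrict_space)
    show "beliefs \<in> sets ?D" by simp
    interpret D: prob_space ?D by (rule J.prob_space_distr[OF post_meas])
    have "AE x in ?D. x \<in> beliefs"
      using post_beliefs by (subst AE_distr_iff[OF post_meas]) auto
    then have "D.prob beliefs = 1"
      by (subst D.prob_eq_1) auto
    then show "emeasure ?D beliefs = 1" by (simp add: D.emeasure_eq_measure)
  qed
  moreover have "sets (posterior_law T \<mu> S \<pi> t) = sets belief_space"
    unfolding posterior_law_def belief_space_def by (rule sets_restrict_space_cong) simp
  ultimately show ?thesis
    by (simp add: belief_law_def belief_law_axioms_def)
qed

text \<open>This links the unordered sum defining the discounted average to an integral over
  periods, by extending the summand by 0 to all natural numbers.\<close>

lemma nn_integral_count_space_infsum:
  fixes f :: "nat \<Rightarrow> ennreal"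
  shows "(\<integral>\<^sup>+t. f t \<partial>count_space P) = (\<Sum>\<^sub>\<infinity>t\<in>P. f t)"
proof -
  have "(\<Sum>\<^sub>\<infinity>t\<in>P. f t) = (\<Sum>\<^sub>\<infinity>t\<in>UNIV. f t * indicator P t)"
    by (rule infsum_cong_neutral) (auto simp: indicator_def)
  also have "\<dots> = (\<Sum>t. f t * indicator P t)"
  proof (rule sums_unique, rule has_sum_imp_sums, rule has_sum_infsum)
    show "(\<lambda>t. f t * indicator P t) summable_on UNIV" by (rule nonneg_summable_on_complete) simp
  qed
  also have "\<dots> = (\<integral>\<^sup>+t. f t \<partial>count_space P)"
    by (simp add: nn_integral_count_space_nat[symmetric] nn_integral_count_space_indicator)
  finally show ?thesis by simp
qed

section \<open>Discounting as the mixture over a random period\<close>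

locale discounting =
  fixes T :: enat and \<beta> :: "nat \<Rightarrow> real"
  assumes \<beta>_nonneg: "\<And>t. t \<in> periods T \<Longrightarrow> 0 \<le> \<beta> t"
    and \<beta>_summable: "\<beta> summable_on periods T"
    and \<beta>_pos: "0 < (\<Sum>\<^sub>\<infinity>t\<in>periods T. \<beta> t)"
begin

definition total_weight :: real where "total_weight = (\<Sum>\<^sub>\<infinity>t\<in>periods T. \<beta> t)"

text \<open>The normalized discount factors are the law of a random period: discounted averages of
  laws are then mixtures, and discounted sums of utilities are expectations up to
  \<open>total_weight\<close>.\<close>

definition weights :: "nat measure" where
  "weights = density (count_space (periods T)) (\<lambda>t. ennreal (\<beta> t / total_weight))"

lemma total_weight_pos: "0 < total_weight"
  using \<beta>_pos by (simp add: total_weight_def)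

lemma weight_nonneg: "t \<in> periods T \<Longrightarrow> 0 \<le> \<beta> t / total_weight"
  using \<beta>_nonneg total_weight_pos by simp

lemma weights_summable: "(\<lambda>t. \<beta> t / total_weight) summable_on periods T"
  using \<beta>_summable by (simp add: divide_inverse summable_on_cmult_left)

lemma integrable_weights: "integrable (count_space (periods T)) (\<lambda>t. \<beta> t / total_weight)"
proof -
  have "norm (\<beta> t / total_weight) = \<beta> t / total_weight" if "t \<in> periods T" for t
    unfolding real_norm_def by (rule abs_of_nonneg[OF weight_nonneg[OF that]])
  then have "(\<lambda>t. norm (\<beta> t / total_weight)) summable_on periods T"
    using weights_summable by (subst summable_on_cong)
  then show ?thesis
    unfolding abs_summable_on_def[symmetric] abs_summable_equivalent[symmetric] .
qed

lemma prob_space_weights: "prob_space weights"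
proof
  have "emeasure weights (space weights) = (\<integral>\<^sup>+t. ennreal (\<beta> t / total_weight) \<partial>count_space (periods T))"
    unfolding weights_def by (subst emeasure_density) (auto intro!: nn_integral_cong)
  also have "\<dots> = ennreal (\<integral>t. \<beta> t / total_weight \<partial>count_space (periods T))"
    by (rule nn_integral_eq_integral)
      (use integrable_weights weight_nonneg in \<open>auto simp: AE_count_space\<close>)
  also have "(\<integral>t. \<beta> t / total_weight \<partial>count_space (periods T)) = (\<Sum>\<^sub>\<infinity>t\<in>periods T. \<beta> t / total_weight)"
    using infsetsum_infsum[OF integrable_weights[folded abs_summable_on_def]] by (simp add: infsetsum_def)
  also have "\<dots> = 1"
    using total_weight_pos by (simp add: divide_inverse infsum_cmult_left' total_weight_def[symmetric])
  finally show "emeasure weights (space weights) = 1" by simp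
qed

context
  fixes F :: "nat \<Rightarrow> (real ^ 'n::finite) measure"
  assumes F: "\<And>t. t \<in> periods T \<Longrightarrow> belief_law (F t)"
begin

lemma kernel_measurable: "F \<in> weights \<rightarrow>\<^sub>M subprob_algebra belief_space"
proof -
  have "F t \<in> space (subprob_algebra belief_space)" if "t \<in> periods T" for t
    using F[OF that] unfolding belief_law_def belief_law_axioms_def
    by (simp add: space_subprob_algebra prob_space_imp_subprob_space)
  then show ?thesis
    unfolding weights_def by (simp add: measurable_cong_sets[OF sets_density refl])
qed

lemma weights_not_empty: "space weights \<noteq> {}"
  by (rule prob_space.not_empty[OF prob_space_weights])

text \<open>Outside of measure spaces \<^const>\<open>measure_of\<close> yields the null measure; the identification with
  a monadic bind supplies the countable additivity.\<close>

lemma discounted_average_eq_bind: "discounted_average T \<beta> F = weights \<bind> F"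
proof -
  have sets: "sets (weights \<bind> F) = sets belief_space"
    by (rule sets_bind[OF sets_kernel[OF kernel_measurable] weights_not_empty])
  then have space: "space (weights \<bind> F) = beliefs"
    using sets_eq_imp_space_eq[OF sets] by simp
  have "discounted_average T \<beta> F = measure_of beliefs (sets belief_space) (emeasure (weights \<bind> F))"
    unfolding discounted_average_def
  proof (rule measure_of_eq)
    show "sets belief_space \<subseteq> Pow (beliefs :: (real ^ 'n) set)"
      using sets.space_closed[of "belief_space :: (real ^ 'n) measure"] by simp
    fix B :: "(real ^ 'n) set" assume "B \<in> sigma_sets beliefs (sets belief_space)"
    then have B: "B \<in> sets belief_space"
      using sets.sigma_sets_eq[of "belief_space :: (real ^ 'n) measure"] by simp
    have "emeasure (weights \<bind> F) B = (\<integral>\<^sup>+t. emeasure (F t) B \<partial>weights)"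
      by (rule emeasure_bind[OF weights_not_empty kernel_measurable B])
    also have "\<dots> = (\<integral>\<^sup>+t. ennreal (\<beta> t / total_weight) * emeasure (F t) B \<partial>count_space (periods T))"
      unfolding weights_def by (rule nn_integral_density) auto
    finally show "(\<Sum>\<^sub>\<infinity>t\<in>periods T. ennreal (\<beta> t / (\<Sum>\<^sub>\<infinity>r\<in>periods T. \<beta> r)) * emeasure (F t) B) =
        emeasure (weights \<bind> F) B"
      by (simp add: nn_integral_count_space_infsum total_weight_def)
  qed
  also have "\<dots> = weights \<bind> F"
    using measure_of_of_measure[of "weights \<bind> F"] by (simp add: sets space)
  finally show ?thesis .
qed

lemma belief_law_discounted_average: "belief_law (discounted_average T \<beta> F)"
proof -
  interpret W: prob_space weights by (rule prob_space_weights)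
  have "prob_space (weights \<bind> F)"
  proof (rule W.prob_space_bind[OF _ kernel_measurable])
    show "AE t in weights. prob_space (F t)"
      by (rule AE_I2) (use F in \<open>auto simp: weights_def belief_law_def\<close>)
  qed
  then show ?thesis
    unfolding discounted_average_eq_bind belief_law_def belief_law_axioms_def
    by (simp add: sets_bind[OF sets_kernel[OF kernel_measurable] weights_not_empty])
qed

text \<open>Integrating against a mixture means integrating over a belief given the period, then
  over the period. The uniform bound \<open>K\<close> gives the integrability that this exchange
  needs, and \<open>total_weight\<close> undoes the normalization.\<close>

lemma integral_discounted_average:
  fixes f :: "real ^ 'n \<Rightarrow> real"
  assumes f: "f \<in> borel_measurable belief_space" and K: "\<And>x. x \<in> beliefs \<Longrightarrow> \<bar>f x\<bar> \<le> K"
  shows "(\<Sum>\<^sub>\<infinity>t\<in>periods T. \<beta> t * (\<integral>x. f x \<partial>F t)) = total_weight * (\<integral>x. f x \<partial>discounted_average T \<beta> F)"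
proof -
  interpret W: prob_space weights by (rule prob_space_weights)
  let ?I = "\<lambda>t. \<integral>x. f x \<partial>F t"
  have I_le: "\<bar>?I t\<bar> \<le> K" if "t \<in> periods T" for t
  proof -
    interpret belief_law "F t" by (rule F[OF that])
    have "integrable (F t) f"
      by (rule integrable_bounded_belief[OF f]) (use K in auto)
    then have "(\<integral>x. \<bar>f x\<bar> \<partial>F t) \<le> (\<integral>x. K \<partial>F t)"
      by (intro integral_mono integrable_abs) (auto intro!: K simp: space_F)
    then show ?thesis
      by (intro order_trans[OF integral_abs_bound]) (simp add: prob_space)
  qed
  have "(\<integral>x. f x \<partial>discounted_average T \<beta> F) = (\<integral>t. ?I t \<partial>weights)"
    unfolding discounted_average_eq_bind
  proof (rule integral_bind[OF f _ kernel_measurable W.finite_measure_axioms])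
    show "\<bar>f x\<bar> \<le> K" if "x \<in> space belief_space" for x using K that by simp
    show "AE t in weights. emeasure (F t) (space (F t)) \<le> ennreal 1"
      by (rule AE_I2)
        (use F in \<open>auto simp: weights_def belief_law_def prob_space.emeasure_space_1\<close>)
  qed
  also have "\<dots> = (\<integral>t. \<beta> t / total_weight * ?I t \<partial>count_space (periods T))"
    unfolding weights_def
    by (subst integral_density) (use weight_nonneg in \<open>auto simp: AE_count_space\<close>)
  also have "\<dots> = (\<Sum>\<^sub>\<infinity>t\<in>periods T. \<beta> t / total_weight * ?I t)"
  proof -
    have "integrable weights ?I"
      by (rule W.integrable_const_bound[where B = K])
        (use I_le in \<open>auto intro!: AE_I2 simp: weights_def\<close>)
    then have "integrable (count_space (periods T)) (\<lambda>t. \<beta> t / total_weight * ?I t)"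
      unfolding weights_def
      by (subst (asm) integrable_density) (use weight_nonneg in \<open>auto simp: AE_count_space\<close>)
    from infsetsum_infsum[OF this[folded abs_summable_on_def]] show ?thesis by (simp add: infsetsum_def)
  qed
  also have "\<dots> = (\<Sum>\<^sub>\<infinity>t\<in>periods T. inverse total_weight * (\<beta> t * ?I t))"
    by (rule infsum_cong) (simp add: divide_inverse)
  also have "\<dots> = inverse total_weight * (\<Sum>\<^sub>\<infinity>t\<in>periods T. \<beta> t * ?I t)"
    by (rule infsum_cmult_right')
  finally show ?thesis using total_weight_pos by (simp add: field_simps)
qed

end

end

text \<open>\<open>W\<close> consists of the utility vectors of the actions; expected utility at a
  belief is the inner product with such a vector. Each coordinate is a continuous real function on a
  compact space, hence bounded, and there are finitely many coordinates.\<close>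

lemma decision_problem_support:
  fixes A :: "'a topology" and v :: "'a \<times> 'n::finite \<Rightarrow> real"
  assumes "decision_problem A v"
  obtains W where "bounded W" "W \<noteq> {}" "indirect_utility A v = support_fun W"
proof -
  define W where "W = (\<lambda>a. \<chi> \<theta>. v (a, \<theta>)) ` topspace A"
  have A: "compact_space A" "topspace A \<noteq> {}"
    and v: "continuous_map (prod_topology A (discrete_topology UNIV)) euclideanreal v"
    using assms by (simp_all add: decision_problem_def)
  have "compact ((\<lambda>a. v (a, \<theta>)) ` topspace A)" for \<theta>
  proof -
    have "continuous_map A (prod_topology A (discrete_topology UNIV)) (\<lambda>a. (a, \<theta>))"
      by (intro continuous_map_pairedI) auto
    from continuous_map_compose[OF this v]
    have "continuous_map A euclideanreal (\<lambda>a. v (a, \<theta>))" by (simp add: comp_def)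
    from image_compactin[OF _ this] A(1) show ?thesis
      by (simp add: compact_space_def)
  qed
  then have "bounded ((\<lambda>a. v (a, \<theta>)) ` topspace A)" for \<theta>
    by (rule compact_imp_bounded)
  then have "\<exists>K. \<forall>a\<in>topspace A. \<bar>v (a, \<theta>)\<bar> \<le> K" for \<theta>
    unfolding bounded_iff ball_simps real_norm_def by blast
  then obtain K where K: "\<And>\<theta> a. a \<in> topspace A \<Longrightarrow> \<bar>v (a, \<theta>)\<bar> \<le> K \<theta>" by metis
  show thesis
  proof
    show "bounded W"
      unfolding bounded_iff W_def
    proof (intro exI ballI, elim imageE, hypsubst)
      fix a assume "a \<in> topspace A"
      then show "norm (\<chi> \<theta>. v (a, \<theta>)) \<le> (\<Sum>\<theta>\<in>UNIV. K \<theta>)"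
        by (intro order_trans[OF norm_le_l1_cart] sum_mono) (simp add: K)
    qed
    show "W \<noteq> {}" using A(2) by (simp add: W_def)
    show "indirect_utility A v = support_fun W"
      by (simp add: fun_eq_iff indirect_utility_def support_fun_def W_def image_image
          inner_vec_def mult.commute)
  qed
qed

text \<open>Each slope becomes an action whose payoff in state \<theta> is the coordinate of the
  slope at \<theta>. Since \<open>n\<close> is arbitrary, the action type must contain arbitrarily
  many points, which \<open>'a::infinite\<close> ensures; a finite discrete space is compact and
  makes every payoff continuous.\<close>

lemma max_lin_decision_problem:
  fixes b :: "nat \<Rightarrow> real ^ 'n::finite"
  obtains A :: "'a::infinite topology" and v
  where "decision_problem A v" "indirect_utility A v = max_lin n b"
proof -
  obtain e :: "nat \<Rightarrow> 'a" where e: "inj e"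
    using infinite_countable_subset[OF infinite_UNIV] by auto
  define A where "A = discrete_topology (e ` {..n})"
  define v where "v = (\<lambda>(a, \<theta>). b (inv e a) $ \<theta>)"
  show thesis
  proof
    show "decision_problem A v"
      unfolding decision_problem_def
    proof (intro conjI)
      show "compact_space A" unfolding A_def by (simp add: compact_space_discrete_topology)
      show "topspace A \<noteq> {}" by (simp add: A_def)
      show "continuous_map (prod_topology A (discrete_topology UNIV)) euclideanreal v"
        unfolding A_def prod_topology_discrete_topology[symmetric] by simp
    qed
    have "indirect_utility A v x = max_lin n b x" for x
    proof -
      have "(\<lambda>a. \<Sum>\<theta>\<in>UNIV. x $ \<theta> * v (a, \<theta>)) ` topspace A = (\<lambda>j. b j \<bullet> x) ` {..n}"
        by (simp add: A_def v_def image_image inv_f_f[OF e] inner_vec_def mult.commute)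
      then show ?thesis
        unfolding indirect_utility_def max_lin_def by (simp add: cSup_eq_Max)
    qed
    then show "indirect_utility A v = max_lin n b" by (simp add: fun_eq_iff)
  qed
qed

theorem theorem3p2:
  fixes T :: enat
    and \<mu> :: "real ^ 'n::finite"
    and \<beta> :: "nat \<Rightarrow> real"
    and S\<^sub>1 :: "nat \<Rightarrow> 's topology"
    and S\<^sub>2 :: "nat \<Rightarrow> 'r topology"
    and \<pi>\<^sub>1 :: "'n \<Rightarrow> (nat \<Rightarrow> 's) measure"
    and \<pi>\<^sub>2 :: "'n \<Rightarrow> (nat \<Rightarrow> 'r) measure"
  assumes "1 \<le> T"
    and "\<mu> \<in> rel_interior beliefs"
    and "\<And>t. t \<in> periods T \<Longrightarrow> 0 \<le> \<beta> t"
    and "\<beta> summable_on periods T"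
    and "0 < (\<Sum>\<^sub>\<infinity>t\<in>periods T. \<beta> t)"
    and "dynamic_information_structure T S\<^sub>1 \<pi>\<^sub>1"
    and "dynamic_information_structure T S\<^sub>2 \<pi>\<^sub>2"
  shows "(\<forall>(A :: 'a::infinite topology) v. decision_problem A v \<longrightarrow>
            optimal_utility T \<beta> \<mu> S\<^sub>1 \<pi>\<^sub>1 A v \<ge> optimal_utility T \<beta> \<mu> S\<^sub>2 \<pi>\<^sub>2 A v) \<longleftrightarrow>
         discounted_average T \<beta> (posterior_law T \<mu> S\<^sub>1 \<pi>\<^sub>1)
           \<succeq> discounted_average T \<beta> (posterior_law T \<mu> S\<^sub>2 \<pi>\<^sub>2)"
proof -
  interpret discounting T \<beta>
    by unfold_locales (rule assms(3-5), assumption?)+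
  have \<mu>: "\<mu> \<in> beliefs" using assms(2) rel_interior_subset by blast
  let ?F = "discounted_average T \<beta> (posterior_law T \<mu> S\<^sub>1 \<pi>\<^sub>1)"
  let ?G = "discounted_average T \<beta> (posterior_law T \<mu> S\<^sub>2 \<pi>\<^sub>2)"
  note laws\<^sub>1 = belief_law_posterior_law[OF \<mu> assms(6)]
  note laws\<^sub>2 = belief_law_posterior_law[OF \<mu> assms(7)]
  have F: "belief_law ?F" and G: "belief_law ?G"
    by (rule belief_law_discounted_average, erule laws\<^sub>1 laws\<^sub>2)+
  \<comment> \<open>Both values are integrals against discounted laws, multiplied by the same
    positive factor. Comparing structures thus reduces to comparing two static laws.\<close>
  have util: "optimal_utility T \<beta> \<mu> S\<^sub>1 \<pi>\<^sub>1 A v = total_weight * (\<integral>x. indirect_utility A v x \<partial>?F)"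
    "optimal_utility T \<beta> \<mu> S\<^sub>2 \<pi>\<^sub>2 A v = total_weight * (\<integral>x. indirect_utility A v x \<partial>?G)"
    if dp: "decision_problem A v" for A :: "'a topology" and v
  proof -
    obtain W where W: "bounded W" "W \<noteq> {}" "indirect_utility A v = support_fun W"
      by (rule decision_problem_support[OF dp])
    obtain K where K: "\<And>w. w \<in> W \<Longrightarrow> norm w \<le> K"
      using W(1) by (auto simp: bounded_iff)
    have V: "support_fun W \<in> borel_measurable belief_space"
      using measurable_compose[OF belief_space_id support_fun_measurable[OF W(1,2)]] by simp
    note V_le = abs_support_fun_le[OF W(2) K]
    show "optimal_utility T \<beta> \<mu> S\<^sub>1 \<pi>\<^sub>1 A v = total_weight * (\<integral>x. indirect_utility A v x \<partial>?F)"
      unfolding optimal_utility_def W(3) by (rule integral_discounted_average[OF laws\<^sub>1 V V_le])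
    show "optimal_utility T \<beta> \<mu> S\<^sub>2 \<pi>\<^sub>2 A v = total_weight * (\<integral>x. indirect_utility A v x \<partial>?G)"
      unfolding optimal_utility_def W(3) by (rule integral_discounted_average[OF laws\<^sub>2 V V_le])
  qed
  \<comment> \<open>Problems with finitely many actions already force \<open>max_lin_order\<close>;
    conversely, that order reaches every compact action set through support functions.\<close>
  have "(\<forall>(A :: 'a topology) v. decision_problem A v \<longrightarrow>
      optimal_utility T \<beta> \<mu> S\<^sub>1 \<pi>\<^sub>1 A v \<ge> optimal_utility T \<beta> \<mu> S\<^sub>2 \<pi>\<^sub>2 A v) \<longleftrightarrow> max_lin_order ?F ?G"
  proof
    assume dom: "\<forall>(A :: 'a topology) v. decision_problem A v \<longrightarrow>
      optimal_utility T \<beta> \<mu> S\<^sub>1 \<pi>\<^sub>1 A v \<ge> optimal_utility T \<beta> \<mu> S\<^sub>2 \<pi>\<^sub>2 A v"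
    show "max_lin_order ?F ?G"
      unfolding max_lin_order_def
    proof (intro allI)
      fix n and b :: "nat \<Rightarrow> real ^ 'n"
      obtain A :: "'a topology" and v where "decision_problem A v" "indirect_utility A v = max_lin n b"
        by (rule max_lin_decision_problem)
      then show "(\<integral>x. max_lin n b x \<partial>?G) \<le> (\<integral>x. max_lin n b x \<partial>?F)"
        using dom[rule_format, of A v] total_weight_pos by (simp add: util)
    qed
  next
    assume ord: "max_lin_order ?F ?G"
    show "\<forall>(A :: 'a topology) v. decision_problem A v \<longrightarrow>
      optimal_utility T \<beta> \<mu> S\<^sub>1 \<pi>\<^sub>1 A v \<ge> optimal_utility T \<beta> \<mu> S\<^sub>2 \<pi>\<^sub>2 A v"
    proof (intro allI impI)
      fix A :: "'a topology" and v :: "'a \<times> 'n \<Rightarrow> real"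
      assume dp: "decision_problem A v"
      then obtain W where "bounded W" "W \<noteq> {}" "indirect_utility A v = support_fun W"
        by (rule decision_problem_support)
      then show "optimal_utility T \<beta> \<mu> S\<^sub>1 \<pi>\<^sub>1 A v \<ge> optimal_utility T \<beta> \<mu> S\<^sub>2 \<pi>\<^sub>2 A v"
        using max_lin_order_support_fun[OF F G ord] total_weight_pos by (simp add: util[OF dp])
    qed
  qed
  then show ?thesis
    unfolding mps_iff_max_lin_order[OF F G] .
qed

end
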